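(* Let $\mathcal K=(K,\mathcal F(K))$ be a field of definable characteristic zero and $\mathbf N=\mathbf N(\mathcal K)$. Given a definable set $Y$ in $\mathcal K^{eq}$, an element $y_0\in Y$ and a definable function $h:\mathbf N\times Y\to Y$, there is a unique definable function $f:\mathbf N\to Y$ satisfying - $f(0)=y_0$, - $f(n+1)=h(n,f(n))$ for all $n\in\mathbf N$.
   Context: "Definable" means first-order definable with parameters. Let $X,Y$ be definable sets in a structure and $\in^*\subseteq X\times Y$ a definable relation. $Y$ is a definable finite power set of $X$ with respect to $\in^*$ (written $\mathcal F(X)=Y$) if: (i) $B,C\in\mathcal F(X)$ are equal iff for all $x\in X$, $x\in^* B\iff x\in^* C$; (ii) there is $\emptyset^*\in\mathcal F(X)$ with $x\notin^*\emptyset^*$ for all $x\in X$; (iii) for each $a\in X$ there is $\{a\}^*\in\mathcal F(X)$ with $x\in^*\{a\}^*\iff x=a$; (iv) for $B,C\in\mathcal F(X)$ there is $B\cup^*C\in\mathcal F(X)$ with $x\in^* B\cup^* C\iff x\in^*B\lor x\in^*C$; (v) every definable $\mathcal U\subseteq\mathcal F(X)$ such that $\emptyset^*\in\mathcal U$ and $B\cup^*\{x\}^*\in\mathcal U$ for all $B\in\mathcal U$, $x\in X$, equals $\mathcal F(X)$. Consider structures $\mathcal K=(K,\mathcal F(K))$ with a field sort $K$, a second sort $\mathcal F(K)$ and a relation $\in^*$ making $\mathcal F(K)$ a definable finite power set of $K$. Let $K_0$ be the set of $x\in K$ for which there is $F\in\mathcal F(K)$ with $x\in^*F$ and, for all $z\in^*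 F$, if $z\ne0$ then $z-1\in^*F$. $\mathcal K$ has definable characteristic zero if $-1\notin K_0$. In that case put $\mathbf N(\mathcal K)=K_0$, which with $+,\cdot$ is a model of Peano Arithmetic satisfying induction for all $\mathcal K$-definable subsets. $\mathcal K^{eq}$ is Shelah's expansion of $\mathcal K$ by sorts for quotients by $\emptyset$-definable equivalence relations; definability here is in $\mathcal K^{eq}$. *)

theory Defs
  imports Main "HOL-Library.FuncSet"
begin

section \<open>Many-sorted first-order logic\<close>

text \<open>
  Languages are relational, function symbols and constants being represented by their graphs
  (formulas are unnested); this does not change which sets are definable.  Variables are de Bruijn
  indices into a list of values, and \<open>well_sorted\<close> checks a formula against the list of sorts of
  its free variables.  A symbol can occur in a well-sorted formula only if its arity consists of
  sorts of the structure.
\<close>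

datatype ('s, 'r) fm =
    FEq nat nat
  | FRel 'r "nat list"
  | FNeg "('s, 'r) fm"
  | FConj "('s, 'r) fm" "('s, 'r) fm"
  | FEx 's "('s, 'r) fm"

record ('s, 'r, 'u) struct =
  sorts :: "'s set"
  arity :: "'r \<Rightarrow> 's list"
  carr :: "'s \<Rightarrow> 'u set"
  interp :: "'r \<Rightarrow> 'u list \<Rightarrow> bool"

primrec well_sorted :: "('s, 'r, 'u) struct \<Rightarrow> 's list \<Rightarrow> ('s, 'r) fm \<Rightarrow> bool" where
  "well_sorted M \<Gamma> (FEq i j) \<longleftrightarrow> i < length \<Gamma> \<and> j < length \<Gamma> \<and> \<Gamma> ! i = \<Gamma> ! j"
| "well_sorted M \<Gamma> (FRel r is) \<longleftrightarrow>
     (\<forall>i\<in>set is. i < length \<Gamma>) \<and> map (\<lambda>i. \<Gamma> ! i) is = arity M r"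
| "well_sorted M \<Gamma> (FNeg \<phi>) \<longleftrightarrow> well_sorted M \<Gamma> \<phi>"
| "well_sorted M \<Gamma> (FConj \<phi> \<psi>) \<longleftrightarrow> well_sorted M \<Gamma> \<phi> \<and> well_sorted M \<Gamma> \<psi>"
| "well_sorted M \<Gamma> (FEx s \<phi>) \<longleftrightarrow> s \<in> sorts M \<and> well_sorted M (s # \<Gamma>) \<phi>"

primrec sat :: "('s, 'r, 'u) struct \<Rightarrow> 'u list \<Rightarrow> ('s, 'r) fm \<Rightarrow> bool" where
  "sat M e (FEq i j) \<longleftrightarrow> e ! i = e ! j"
| "sat M e (FRel r is) \<longleftrightarrow> interp M r (map (\<lambda>i. e ! i) is)"
| "sat M e (FNeg \<phi>) \<longleftrightarrow> \<not> sat M e \<phi>"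
| "sat M e (FConj \<phi> \<psi>) \<longleftrightarrow> sat M e \<phi> \<and> sat M e \<psi>"
| "sat M e (FEx s \<phi>) \<longleftrightarrow> (\<exists>x\<in>carr M s. sat M (x # e) \<phi>)"

definition tuples :: "('s, 'r, 'u) struct \<Rightarrow> 's list \<Rightarrow> 'u list set" where
  "tuples M ss = {xs. list_all2 (\<lambda>x s. x \<in> carr M s) xs ss}"

text \<open>\<open>A\<close> is a subset of the product of the sorts \<open>ss\<close>, definable with parameters from \<open>C\<close>.\<close>

definition definable_over ::
  "('s, 'r, 'u) struct \<Rightarrow> 'u set \<Rightarrow> 's list \<Rightarrow> 'u list set \<Rightarrow> bool" where
  "definable_over M C ss A \<longleftrightarrow> set ss \<subseteq> sorts M \<and>
     (\<exists>ts ps \<phi>. set ts \<subseteq> sorts M \<and> ps \<in> tuples M ts \<and> set ps \<subseteq> C \<and>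
        well_sorted M (ss @ ts) \<phi> \<and>
        A = {xs \<in> tuples M ss. sat M (xs @ ps) \<phi>})"

abbreviation definable :: "('s, 'r, 'u) struct \<Rightarrow> 's list \<Rightarrow> 'u list set \<Rightarrow> bool" where
  "definable M \<equiv> definable_over M UNIV"


section \<open>Shelah's expansion by imaginary sorts\<close>

text \<open>
  A quotient sort is indexed by a tuple of home sorts and an equivalence relation on their product
  (the relation itself rather than a formula defining it).  Its elements are the equivalence
  classes, tagged with the sort so that distinct sorts are disjoint.
\<close>

datatype ('s, 'u) eq_sort =
    HomeSort 's
  | QuotSort "'s list" "('u list \<times> 'u list) set"

datatype ('s, 'r, 'u) eq_sym =
    HomeSym 'r
  | ProjSym "'s list" "('u list \<times> 'u list) set"

datatype ('s, 'u) eq_elem =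
    HomeElem 'u
  | ClassElem "'s list" "('u list \<times> 'u list) set" "'u list set"

definition zero_definable_equiv ::
  "('s, 'r, 'u) struct \<Rightarrow> 's list \<Rightarrow> ('u list \<times> 'u list) set \<Rightarrow> bool" where
  "zero_definable_equiv M ss E \<longleftrightarrow>
     equiv (tuples M ss) E \<and> definable_over M {} (ss @ ss) {xs @ ys | xs ys. (xs, ys) \<in> E}"

primrec eq_arity :: "('s, 'r, 'u) struct \<Rightarrow> ('s, 'r, 'u) eq_sym \<Rightarrow> ('s, 'u) eq_sort list" where
  "eq_arity M (HomeSym r) = map HomeSort (arity M r)"
| "eq_arity M (ProjSym ss E) = map HomeSort ss @ [QuotSort ss E]"

primrec eq_carr :: "('s, 'r, 'u) struct \<Rightarrow> ('s, 'u) eq_sort \<Rightarrow> ('s, 'u) eq_elem set" where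
  "eq_carr M (HomeSort s) = HomeElem ` carr M s"
| "eq_carr M (QuotSort ss E) = ClassElem ss E ` (tuples M ss // E)"

primrec eq_interp ::
  "('s, 'r, 'u) struct \<Rightarrow> ('s, 'r, 'u) eq_sym \<Rightarrow> ('s, 'u) eq_elem list \<Rightarrow> bool" where
  "eq_interp M (HomeSym r) us \<longleftrightarrow> (\<exists>xs. us = map HomeElem xs \<and> interp M r xs)"
| "eq_interp M (ProjSym ss E) us \<longleftrightarrow>
     (\<exists>xs\<in>tuples M ss. us = map HomeElem xs @ [ClassElem ss E (E `` {xs})])"

definition eq_struct ::
  "('s, 'r, 'u) struct \<Rightarrow> (('s, 'u) eq_sort, ('s, 'r, 'u) eq_sym, ('s, 'u) eq_elem) struct" where
  "eq_struct M =
     \<lparr>sorts = HomeSort ` sorts M \<union> {QuotSort ss E | ss E. zero_definable_equiv M ss E},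
      arity = eq_arity M, carr = eq_carr M, interp = eq_interp M\<rparr>"


section \<open>Definable finite power sets\<close>

text \<open>
  The operations are well defined on \<open>Y\<close> under the existence and extensionality clauses of
  \<open>definable_finite_powerset\<close> below.
\<close>

definition star_empty :: "'x set \<Rightarrow> 'y set \<Rightarrow> ('x \<Rightarrow> 'y \<Rightarrow> bool) \<Rightarrow> 'y" where
  "star_empty X Y mem = (THE e. e \<in> Y \<and> (\<forall>x\<in>X. \<not> mem x e))"

definition star_single :: "'x set \<Rightarrow> 'y set \<Rightarrow> ('x \<Rightarrow> 'y \<Rightarrow> bool) \<Rightarrow> 'x \<Rightarrow> 'y" where
  "star_single X Y mem a = (THE s. s \<in> Y \<and> (\<forall>x\<in>X. mem x s \<longleftrightarrow> x = a))"

definition star_union :: "'x set \<Rightarrow> 'y set \<Rightarrow> ('x \<Rightarrow> 'y \<Rightarrow> bool) \<Rightarrow> 'y \<Rightarrow> 'y \<Rightarrow> 'y" where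
  "star_union X Y mem B C = (THE D. D \<in> Y \<and> (\<forall>x\<in>X. mem x D \<longleftrightarrow> mem x B \<or> mem x C))"

definition definable_finite_powerset ::
  "('s, 'r, 'u) struct \<Rightarrow> 's list \<Rightarrow> 'u list set \<Rightarrow> 's list \<Rightarrow> 'u list set \<Rightarrow>
   ('u list \<Rightarrow> 'u list \<Rightarrow> bool) \<Rightarrow> bool" where
  "definable_finite_powerset M ss X ts Y mem \<longleftrightarrow>
     definable M ss X \<and> definable M ts Y \<and>
     definable M (ss @ ts) {x @ y | x y. x \<in> X \<and> y \<in> Y \<and> mem x y} \<and>
     (\<forall>B\<in>Y. \<forall>C\<in>Y. B = C \<longleftrightarrow> (\<forall>x\<in>X. mem x B \<longleftrightarrow> mem x C)) \<and>
     (\<exists>e\<in>Y. \<forall>x\<in>X. \<not> mem x e) \<and>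
     (\<forall>a\<in>X. \<exists>s\<in>Y. \<forall>x\<in>X. mem x s \<longleftrightarrow> x = a) \<and>
     (\<forall>B\<in>Y. \<forall>C\<in>Y. \<exists>D\<in>Y. \<forall>x\<in>X. mem x D \<longleftrightarrow> mem x B \<or> mem x C) \<and>
     (\<forall>U. U \<subseteq> Y \<and> definable M ts U \<and> star_empty X Y mem \<in> U \<and>
          (\<forall>B\<in>U. \<forall>x\<in>X. star_union X Y mem B (star_single X Y mem x) \<in> U) \<longrightarrow> U = Y)"


section \<open>Fields with a definable finite power set\<close>

datatype kf_sort = SortK | SortF

datatype kf_sym = ZeroSym | OneSym | PlusSym | TimesSym | MemSym

datatype ('k, 'f) kf_elem = ElemK 'k | ElemF 'f

primrec kf_arity :: "kf_sym \<Rightarrow> kf_sort list" where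
  "kf_arity ZeroSym = [SortK]"
| "kf_arity OneSym = [SortK]"
| "kf_arity PlusSym = [SortK, SortK, SortK]"
| "kf_arity TimesSym = [SortK, SortK, SortK]"
| "kf_arity MemSym = [SortK, SortF]"

primrec kf_carr :: "kf_sort \<Rightarrow> ('k, 'f) kf_elem set" where
  "kf_carr SortK = range ElemK"
| "kf_carr SortF = range ElemF"

primrec kf_interp ::
  "('k::field \<Rightarrow> 'f \<Rightarrow> bool) \<Rightarrow> kf_sym \<Rightarrow> ('k, 'f) kf_elem list \<Rightarrow> bool" where
  "kf_interp mem ZeroSym us \<longleftrightarrow> us = [ElemK 0]"
| "kf_interp mem OneSym us \<longleftrightarrow> us = [ElemK 1]"
| "kf_interp mem PlusSym us \<longleftrightarrow> (\<exists>x y. us = [ElemK x, ElemK y, ElemK (x + y)])"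
| "kf_interp mem TimesSym us \<longleftrightarrow> (\<exists>x y. us = [ElemK x, ElemK y, ElemK (x * y)])"
| "kf_interp mem MemSym us \<longleftrightarrow> (\<exists>x B. us = [ElemK x, ElemF B] \<and> mem x B)"

definition kf_struct ::
  "('k::field \<Rightarrow> 'f \<Rightarrow> bool) \<Rightarrow> (kf_sort, kf_sym, ('k, 'f) kf_elem) struct" where
  "kf_struct mem = \<lparr>sorts = UNIV, arity = kf_arity, carr = kf_carr, interp = kf_interp mem\<rparr>"

definition has_finite_powerset :: "('k::field \<Rightarrow> 'f \<Rightarrow> bool) \<Rightarrow> bool" where
  "has_finite_powerset mem \<longleftrightarrow>
     definable_finite_powerset (kf_struct mem)
       [SortK] {[ElemK x] | x. True} [SortF] {[ElemF B] | B. True}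
       (\<lambda>us vs. \<exists>x B. us = [ElemK x] \<and> vs = [ElemF B] \<and> mem x B)"

definition K0 :: "('k::field \<Rightarrow> 'f \<Rightarrow> bool) \<Rightarrow> 'k set" where
  "K0 mem = {x. \<exists>F. mem x F \<and> (\<forall>z. mem z F \<longrightarrow> z \<noteq> 0 \<longrightarrow> mem (z - 1) F)}"

definition definable_char_zero :: "('k::field \<Rightarrow> 'f \<Rightarrow> bool) \<Rightarrow> bool" where
  "definable_char_zero mem \<longleftrightarrow> has_finite_powerset mem \<and> - 1 \<notin> K0 mem"

text \<open>\<open>K0\<close> in its role as the arithmetic of a field of definable characteristic zero.\<close>

abbreviation NN :: "('k::field \<Rightarrow> 'f \<Rightarrow> bool) \<Rightarrow> 'k set" where
  "NN \<equiv> K0"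

type_synonym ('k, 'f) imag_sort = "(kf_sort, ('k, 'f) kf_elem) eq_sort"
type_synonym ('k, 'f) imag = "(kf_sort, ('k, 'f) kf_elem) eq_elem"

abbreviation fieldK :: "('k, 'f) imag_sort" where
  "fieldK \<equiv> HomeSort SortK"

abbreviation inK :: "'k \<Rightarrow> ('k, 'f) imag" where
  "inK x \<equiv> HomeElem (ElemK x)"

end

theory Submission
  imports Defs
begin

text \<open>
  The function \<open>f\<close> is defined through its finite approximations: \<open>f n = y\<close> means that some coded
  sequence starts with \<open>y0\<close>, follows \<open>h\<close> at every step below \<open>n\<close>, and has \<open>y\<close> as its entry at \<open>n\<close>
  (\<open>reached\<close>).  Induction over \<open>N = K0\<close> shows that exactly one \<open>y\<close> is reached at each \<open>n\<close>, and a
  second induction that a definable solution cannot differ from \<open>f\<close>.  The substance is in what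
  makes these inductions possible.

  \<^item> The hypothesis on \<open>F(K)\<close> is an induction principle for sets definable in \<open>(K, F(K))\<close>, but \<open>h\<close>
    and the entries of the sequences involve imaginaries.  A relation between imaginaries,
    read as a relation between their representatives, is definable without imaginaries
    (\<open>dpred_imags_of\<close>), so the principle extends to all sets definable in the expansion by
    imaginaries (\<open>F_induct\<close>).

  \<^item> Call a subset of \<open>K\<close> pseudofinite if it is coded in \<open>F(K)\<close>.  Pseudofinite sets are closed under
    definable subsets and images and under pseudofinite unions (\<open>pfinite_UN\<close>).  A pseudofinite set
    that contains 0 and is closed under \<open>z \<mapsto> z - 1\<close> would witness \<open>- 1 \<in> K0\<close>.  Hence \<open>K\<close> is not
    pseudofinite.  Induction over \<open>N\<close> (\<open>NN_induct\<close>) follows in the same way: if it failed at \<open>n\<close>,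
    the translate by \<open>- n\<close> of the failures in a witness of \<open>n \<in> K0\<close> would be such a set.

  \<^item> No power set of \<open>K \<times> K\<close> is given, let alone one of a sort of imaginaries.  A pseudofinite
    \<open>S \<subseteq> K \<times> K\<close> is coded by sets \<open>A\<close>, \<open>B\<close> in \<open>F(K)\<close> containing its projections, a slope \<open>t\<close> for which
    \<open>(j, x) \<mapsto> j + t * x\<close> is injective on \<open>A \<times> B\<close>, and the image \<open>C\<close> of \<open>S\<close> under this map
    (\<open>fiber\<close>); a slope exists because only pseudofinitely many are bad (\<open>separating_slope\<close>).
    The fibers of \<open>S\<close> are elements of \<open>F(K)\<close>, so \<open>S\<close> is a family of finite sets.  An imaginary is
    given by a representative in the home sorts, and each coordinate of a representative by
    an element of \<open>F(K)\<close>, a field element \<open>a\<close> being stored as \<open>{a}\<close>.  A sequence of tuples that need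
    \<open>d\<close> such coordinates is stored in the fibers over \<open>d * k + i\<close> with \<open>k\<close> in \<open>N\<close> and \<open>i < d\<close>.
    Representatives need not be chosen uniformly, since a computation is extended by one entry at
    a time (\<open>seq_val_extend\<close>).
\<close>

section \<open>Formulas, tuples and definable predicates\<close>

text \<open>The index under a quantifier is 0, so there the renaming is shifted.\<close>

primrec rename :: "(nat \<Rightarrow> nat) \<Rightarrow> ('s, 'r) fm \<Rightarrow> ('s, 'r) fm" where
  "rename f (FEq i j) = FEq (f i) (f j)"
| "rename f (FRel r is) = FRel r (map f is)"
| "rename f (FNeg \<phi>) = FNeg (rename f \<phi>)"
| "rename f (FConj \<phi> \<psi>) = FConj (rename f \<phi>) (rename f \<psi>)"
| "rename f (FEx s \<phi>) = FEx s (rename (case_nat 0 (\<lambda>i. Suc (f i))) \<phi>)"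

lemma well_sorted_rename:
  assumes "well_sorted M \<Gamma> \<phi>" "\<And>i. i < length \<Gamma> \<Longrightarrow> f i < length \<Delta> \<and> \<Delta> ! f i = \<Gamma> ! i"
  shows "well_sorted M \<Delta> (rename f \<phi>)"
  using assms
proof (induction \<phi> arbitrary: \<Gamma> \<Delta> f)
  case (FRel r "is")
  then have "map (\<lambda>i. \<Delta> ! i) (map f is) = arity M r" by (auto cong: map_cong)
  moreover have "\<forall>i\<in>set (map f is). i < length \<Delta>" using FRel by auto
  ultimately show ?case by (simp only: rename.simps well_sorted.simps simp_thms)
next
  case (FEx s \<phi>)
  then have "well_sorted M (s # \<Delta>) (rename (case_nat 0 (\<lambda>i. Suc (f i))) \<phi>)"
    by (intro FEx.IH[of "s # \<Gamma>"]) (auto split: nat.split)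
  with FEx show ?case by simp
qed auto

lemma sat_rename:
  assumes "well_sorted M \<Gamma> \<phi>" "\<And>i. i < length \<Gamma> \<Longrightarrow> d ! f i = e ! i"
  shows "sat M d (rename f \<phi>) \<longleftrightarrow> sat M e \<phi>"
  using assms
proof (induction \<phi> arbitrary: \<Gamma> d e f)
  case (FRel r "is")
  then have "map (\<lambda>i. d ! i) (map f is) = map (\<lambda>i. e ! i) is" by auto
  then show ?case by (simp del: map_map)
next
  case (FEx s \<phi>)
  have "sat M (x # d) (rename (case_nat 0 (\<lambda>i. Suc (f i))) \<phi>) \<longleftrightarrow> sat M (x # e) \<phi>" for x
    using FEx.prems by (intro FEx.IH[of "s # \<Gamma>"]) (auto split: nat.split)
  then show ?case by simp
qed auto

lemma tuples_Nil [simp]: "xs \<in> tuples M [] \<longleftrightarrow> xs = []"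
  by (simp add: tuples_def)

lemma tuples_length: "xs \<in> tuples M ss \<Longrightarrow> length xs = length ss"
  by (simp add: tuples_def list_all2_lengthD)

lemma tuples_nth: "xs \<in> tuples M ss \<Longrightarrow> i < length ss \<Longrightarrow> xs ! i \<in> carr M (ss ! i)"
  by (simp add: tuples_def list_all2_conv_all_nth)

lemma tuples_iff:
  "xs \<in> tuples M ss \<longleftrightarrow> length xs = length ss \<and> (\<forall>i<length ss. xs ! i \<in> carr M (ss ! i))"
  by (auto simp: tuples_def list_all2_conv_all_nth)

lemma tuples_Cons: "xs \<in> tuples M (s # ss) \<longleftrightarrow> (\<exists>y ys. xs = y # ys \<and> y \<in> carr M s \<and> ys \<in> tuples M ss)"
  by (auto simp: tuples_def list_all2_Cons2)

lemma tuples_Cons_simp [simp]: "x # xs \<in> tuples M (s # ss) \<longleftrightarrow> x \<in> carr M s \<and> xs \<in> tuples M ss"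
  by (auto simp: tuples_def)

lemma tuples_append:
  "zs \<in> tuples M (ss @ ts) \<longleftrightarrow> (\<exists>xs ys. zs = xs @ ys \<and> xs \<in> tuples M ss \<and> ys \<in> tuples M ts)"
proof
  assume "zs \<in> tuples M (ss @ ts)"
  then show "\<exists>xs ys. zs = xs @ ys \<and> xs \<in> tuples M ss \<and> ys \<in> tuples M ts"
    by (auto simp: tuples_def list_all2_append2)
qed (auto simp: tuples_def intro: list_all2_appendI)

lemma tuples_appendI: "xs \<in> tuples M ss \<Longrightarrow> ys \<in> tuples M ts \<Longrightarrow> xs @ ys \<in> tuples M (ss @ ts)"
  by (auto simp: tuples_append)

lemma tuples_select:
  assumes "xs \<in> tuples M \<Gamma>" "\<forall>i\<in>set is. i < length \<Gamma>" "map (\<lambda>i. \<Gamma> ! i) is = \<Delta>"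
  shows "map (\<lambda>i. xs ! i) is \<in> tuples M \<Delta>"
  using assms by (auto simp: tuples_iff)

text \<open>
  Definability of a predicate that is of interest on tuples of the right sorts only.  Unlike
  \<open>definable\<close>, it can be used with any HOL predicate, so that closure of definability under the
  logical operations is closure under the HOL connectives.
\<close>

definition dpred :: "('s, 'r, 'u) struct \<Rightarrow> 's list \<Rightarrow> ('u list \<Rightarrow> bool) \<Rightarrow> bool" where
  "dpred M \<Gamma> P \<longleftrightarrow> set \<Gamma> \<subseteq> sorts M \<and>
     (\<exists>ts ps \<phi>. set ts \<subseteq> sorts M \<and> ps \<in> tuples M ts \<and> well_sorted M (\<Gamma> @ ts) \<phi> \<and>
        (\<forall>xs\<in>tuples M \<Gamma>. P xs \<longleftrightarrow> sat M (xs @ ps) \<phi>))"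

lemma dpredI:
  assumes "set \<Gamma> \<subseteq> sorts M" "well_sorted M \<Gamma> \<phi>"
    "\<And>xs. xs \<in> tuples M \<Gamma> \<Longrightarrow> P xs \<longleftrightarrow> sat M xs \<phi>"
  shows "dpred M \<Gamma> P"
  unfolding dpred_def using assms
  by (intro conjI exI[of _ "[]"] exI[of _ \<phi>]) auto

lemma definable_dpred:
  "definable_over M C \<Gamma> A \<Longrightarrow> dpred M \<Gamma> (\<lambda>xs. xs \<in> A)"
  unfolding dpred_def definable_over_def by blast

lemma dpred_definable:
  "dpred M \<Gamma> P \<Longrightarrow> definable M \<Gamma> {xs \<in> tuples M \<Gamma>. P xs}"
  unfolding dpred_def definable_over_def
  by (auto cong: conj_cong) blast

lemma definable_subset: "definable_over M C \<Gamma> A \<Longrightarrow> A \<subseteq> tuples M \<Gamma>"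
  by (auto simp: definable_over_def)

lemma dpred_sorts: "dpred M \<Gamma> P \<Longrightarrow> set \<Gamma> \<subseteq> sorts M"
  by (simp add: dpred_def)

lemma dpred_cong:
  assumes "dpred M \<Gamma> P" "\<And>xs. xs \<in> tuples M \<Gamma> \<Longrightarrow> P xs \<longleftrightarrow> Q xs"
  shows "dpred M \<Gamma> Q"
  using assms unfolding dpred_def by (auto cong: ball_cong)

text \<open>
  Variables may be permuted, duplicated and added.  Parameters follow the variables in the context
  of a formula, hence the shift in the renaming.
\<close>

lemma dpred_subst:
  assumes P: "dpred M \<Delta> P" and \<Gamma>: "set \<Gamma> \<subseteq> sorts M"
    and len: "\<forall>i\<in>set is. i < length \<Gamma>" and block: "map (\<lambda>i. \<Gamma> ! i) is = \<Delta>"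
  shows "dpred M \<Gamma> (\<lambda>xs. P (map (\<lambda>i. xs ! i) is))"
proof -
  obtain ts ps \<phi> where *: "set ts \<subseteq> sorts M" "ps \<in> tuples M ts" "well_sorted M (\<Delta> @ ts) \<phi>"
    "\<And>xs. xs \<in> tuples M \<Delta> \<Longrightarrow> P xs \<longleftrightarrow> sat M (xs @ ps) \<phi>"
    using P by (auto simp: dpred_def)
  define f where "f i = (if i < length \<Delta> then is ! i else length \<Gamma> + (i - length \<Delta>))" for i
  have l: "length is = length \<Delta>" using block by auto
  have "well_sorted M (\<Gamma> @ ts) (rename f \<phi>)"
  proof (intro well_sorted_rename[OF *(3)])
    fix i assume i: "i < length (\<Delta> @ ts)"
    have "is ! i < length \<Gamma>" "\<Gamma> ! (is ! i) = \<Delta> ! i" if "i < length \<Delta>"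
      using len l that nth_map[of i "is" "\<lambda>i. \<Gamma> ! i"] by (auto simp: block)
    with i show "f i < length (\<Gamma> @ ts) \<and> (\<Gamma> @ ts) ! f i = (\<Delta> @ ts) ! i"
      by (auto simp: f_def nth_append)
  qed
  moreover have "P (map (\<lambda>i. xs ! i) is) \<longleftrightarrow> sat M (xs @ ps) (rename f \<phi>)" if "xs \<in> tuples M \<Gamma>" for xs
  proof -
    have "sat M (xs @ ps) (rename f \<phi>) \<longleftrightarrow> sat M (map (\<lambda>i. xs ! i) is @ ps) \<phi>"
      using len l tuples_length[OF that]
      by (intro sat_rename[OF *(3)]) (auto simp: f_def nth_append)
    with *(4)[OF tuples_select[OF that len block]] show ?thesis by simp
  qed
  ultimately show ?thesis
    unfolding dpred_def using \<Gamma> *(1,2) by blast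
qed

lemma dpred_not:
  assumes "dpred M \<Gamma> P" shows "dpred M \<Gamma> (\<lambda>xs. \<not> P xs)"
proof -
  obtain ts ps \<phi> where "set ts \<subseteq> sorts M" "ps \<in> tuples M ts" "well_sorted M (\<Gamma> @ ts) \<phi>"
    "\<forall>xs\<in>tuples M \<Gamma>. P xs \<longleftrightarrow> sat M (xs @ ps) \<phi>"
    using assms by (auto simp: dpred_def)
  then show ?thesis
    unfolding dpred_def using dpred_sorts[OF assms]
    by (intro conjI exI[of _ ts] exI[of _ ps] exI[of _ "FNeg \<phi>"]) auto
qed

lemma dpred_conj:
  assumes "dpred M \<Gamma> P" "dpred M \<Gamma> Q" shows "dpred M \<Gamma> (\<lambda>xs. P xs \<and> Q xs)"
proof -
  obtain ts ps \<phi> where 1: "set ts \<subseteq> sorts M" "ps \<in> tuples M ts" "well_sorted M (\<Gamma> @ ts) \<phi>"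
    "\<forall>xs\<in>tuples M \<Gamma>. P xs \<longleftrightarrow> sat M (xs @ ps) \<phi>"
    using assms by (auto simp: dpred_def)
  obtain us qs \<psi> where 2: "set us \<subseteq> sorts M" "qs \<in> tuples M us" "well_sorted M (\<Gamma> @ us) \<psi>"
    "\<forall>xs\<in>tuples M \<Gamma>. Q xs \<longleftrightarrow> sat M (xs @ qs) \<psi>"
    using assms by (auto simp: dpred_def)
  define f where "f i = (if i < length \<Gamma> then i else i + length ts)" for i
  have "well_sorted M (\<Gamma> @ ts @ us) (rename id \<phi>)"
    by (intro well_sorted_rename[OF 1(3)]) (auto simp: nth_append)
  moreover have "well_sorted M (\<Gamma> @ ts @ us) (rename f \<psi>)"
    by (intro well_sorted_rename[OF 2(3)]) (auto simp: nth_append f_def)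
  moreover have "P xs \<and> Q xs \<longleftrightarrow> sat M (xs @ ps @ qs) (FConj (rename id \<phi>) (rename f \<psi>))"
    if xs: "xs \<in> tuples M \<Gamma>" for xs
  proof -
    note l = tuples_length[OF xs] tuples_length[OF 1(2)] tuples_length[OF 2(2)]
    have "sat M (xs @ ps @ qs) (rename id \<phi>) \<longleftrightarrow> sat M (xs @ ps) \<phi>"
      using l by (intro sat_rename[OF 1(3)]) (auto simp: nth_append)
    moreover have "sat M (xs @ ps @ qs) (rename f \<psi>) \<longleftrightarrow> sat M (xs @ qs) \<psi>"
      using l by (intro sat_rename[OF 2(3)]) (auto simp: nth_append f_def)
    ultimately show ?thesis using 1(4) 2(4) xs by simp
  qed
  ultimately show ?thesis
    unfolding dpred_def using dpred_sorts[OF assms(1)] 1(1,2) 2(1,2)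
    by (intro conjI exI[of _ "ts @ us"] exI[of _ "ps @ qs"] exI[of _ "FConj (rename id \<phi>) (rename f \<psi>)"])
       (auto intro: tuples_appendI)
qed

lemma dpred_ex:
  assumes "dpred M (s # \<Gamma>) P" shows "dpred M \<Gamma> (\<lambda>xs. \<exists>x\<in>carr M s. P (x # xs))"
proof -
  obtain ts ps \<phi> where "set ts \<subseteq> sorts M" "ps \<in> tuples M ts" "well_sorted M (s # \<Gamma> @ ts) \<phi>"
    "\<forall>xs\<in>tuples M (s # \<Gamma>). P xs \<longleftrightarrow> sat M (xs @ ps) \<phi>"
    using assms by (auto simp: dpred_def)
  then show ?thesis
    unfolding dpred_def using dpred_sorts[OF assms]
    by (intro conjI exI[of _ ts] exI[of _ ps] exI[of _ "FEx s \<phi>"]) auto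
qed

lemma dpred_exs:
  assumes "dpred M (\<Delta> @ \<Gamma>) P" shows "dpred M \<Gamma> (\<lambda>xs. \<exists>zs\<in>tuples M \<Delta>. P (zs @ xs))"
  using assms
proof (induction \<Delta> arbitrary: P)
  case (Cons s \<Delta>)
  have "dpred M \<Gamma> (\<lambda>xs. \<exists>zs\<in>tuples M \<Delta>. \<exists>x\<in>carr M s. P (x # zs @ xs))"
    using Cons.IH[OF dpred_ex] Cons.prems by simp
  then show ?case by (rule dpred_cong) (force simp: tuples_Cons)
qed simp

lemma dpred_param:
  assumes "dpred M (\<Gamma> @ \<Delta>) P" "qs \<in> tuples M \<Delta>" shows "dpred M \<Gamma> (\<lambda>xs. P (xs @ qs))"
proof -
  obtain ts ps \<phi> where "set ts \<subseteq> sorts M" "ps \<in> tuples M ts" "well_sorted M (\<Gamma> @ \<Delta> @ ts) \<phi>"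
    "\<forall>xs\<in>tuples M (\<Gamma> @ \<Delta>). P xs \<longleftrightarrow> sat M (xs @ ps) \<phi>"
    using assms(1) by (auto simp: dpred_def)
  then show ?thesis
    unfolding dpred_def using dpred_sorts[OF assms(1)] assms(2)
    by (intro conjI exI[of _ "\<Delta> @ ts"] exI[of _ "qs @ ps"] exI[of _ \<phi>])
       (auto simp: tuples_appendI)
qed

lemma dpred_eq:
  assumes "set \<Gamma> \<subseteq> sorts M" "i < length \<Gamma>" "j < length \<Gamma>" "\<Gamma> ! i = \<Gamma> ! j"
  shows "dpred M \<Gamma> (\<lambda>xs. xs ! i = xs ! j)"
  using assms by (intro dpredI[where \<phi> = "FEq i j"]) auto

lemma dpred_rel:
  assumes "set \<Gamma> \<subseteq> sorts M" "\<forall>i\<in>set is. i < length \<Gamma>" "map (\<lambda>i. \<Gamma> ! i) is = arity M r"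
  shows "dpred M \<Gamma> (\<lambda>xs. interp M r (map (\<lambda>i. xs ! i) is))"
  using assms by (intro dpredI[where \<phi> = "FRel r is"]) auto

text \<open>An atomic formula has variables, so that a true sentence needs a sort to quantify over.\<close>

lemma dpred_True:
  assumes "set \<Gamma> \<subseteq> sorts M" "s \<in> sorts M" shows "dpred M \<Gamma> (\<lambda>xs. True)"
  using assms
  by (intro dpredI[where \<phi> = "FNeg (FEx s (FNeg (FEq 0 0)))"]) auto

lemma dpred_all_less:
  fixes n :: nat
  assumes "set \<Gamma> \<subseteq> sorts M" "s \<in> sorts M" "\<And>i. i < n \<Longrightarrow> dpred M \<Gamma> (P i)"
  shows "dpred M \<Gamma> (\<lambda>xs. \<forall>i<n. P i xs)"
  using assms
proof (induction n)
  case 0 then show ?case using dpred_True by simp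
next
  case (Suc n)
  have "dpred M \<Gamma> (\<lambda>xs. (\<forall>i<n. P i xs) \<and> P n xs)"
    using Suc by (intro dpred_conj) auto
  then show ?case by (rule dpred_cong) (auto simp: less_Suc_eq)
qed

section \<open>Elimination of imaginaries\<close>

primrec rep_sorts :: "('s, 'u) eq_sort \<Rightarrow> 's list" where
  "rep_sorts (HomeSort s) = [s]"
| "rep_sorts (QuotSort ds E) = ds"

text \<open>
  The element of a sort of the expansion that a list of home elements represents, and likewise, with
  the representatives concatenated, for a list of sorts.
\<close>

primrec imag_of :: "('s, 'u) eq_sort \<Rightarrow> 'u list \<Rightarrow> ('s, 'u) eq_elem" where
  "imag_of (HomeSort s) zs = HomeElem (hd zs)"
| "imag_of (QuotSort ds E) zs = ClassElem ds E (E `` {zs})"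

primrec imags_of :: "('s, 'u) eq_sort list \<Rightarrow> 'u list \<Rightarrow> ('s, 'u) eq_elem list" where
  "imags_of [] zs = []"
| "imags_of (s # \<Gamma>) zs = imag_of s (take (length (rep_sorts s)) zs) # imags_of \<Gamma> (drop (length (rep_sorts s)) zs)"

text \<open>Representatives are concatenated, and the one of component \<open>i\<close> begins at this place.\<close>

definition offset :: "('s, 'u) eq_sort list \<Rightarrow> nat \<Rightarrow> nat" where
  "offset \<Gamma> i = length (concat (map rep_sorts (take i \<Gamma>)))"

abbreviation allsorts :: "('s, 'u) eq_sort list \<Rightarrow> 's list" where
  "allsorts \<Gamma> \<equiv> concat (map rep_sorts \<Gamma>)"

abbreviation blockpos :: "('s, 'u) eq_sort list \<Rightarrow> nat \<Rightarrow> nat list" where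
  "blockpos \<Gamma> i \<equiv> [offset \<Gamma> i..<offset \<Gamma> i + length (rep_sorts (\<Gamma> ! i))]"

lemma carr_eq_struct: "carr (eq_struct M) s = imag_of s ` tuples M (rep_sorts s)"
proof (cases s)
  case (HomeSort t)
  then show ?thesis by (force simp: eq_struct_def tuples_Cons image_iff)
next
  case (QuotSort ds E)
  then show ?thesis by (auto simp: eq_struct_def quotient_def)
qed

lemma rep_sorts_sorts:
  assumes "s \<in> sorts (eq_struct M)" shows "set (rep_sorts s) \<subseteq> sorts M"
  using assms by (auto simp: eq_struct_def zero_definable_equiv_def definable_over_def)

lemma allsorts_sorts: "set \<Gamma> \<subseteq> sorts (eq_struct M) \<Longrightarrow> set (allsorts \<Gamma>) \<subseteq> sorts M"
  using rep_sorts_sorts by fastforce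

lemma length_imags_of [simp]: "length (imags_of \<Gamma> zs) = length \<Gamma>"
  by (induction \<Gamma> arbitrary: zs) auto

lemma imags_of_append:
  "length zs = length (allsorts \<Gamma>) \<Longrightarrow> imags_of (\<Gamma> @ \<Delta>) (zs @ ws) = imags_of \<Gamma> zs @ imags_of \<Delta> ws"
proof (induction \<Gamma> arbitrary: zs)
  case (Cons s \<Gamma>)
  have "imags_of (\<Gamma> @ \<Delta>) (drop (length (rep_sorts s)) zs @ ws)
      = imags_of \<Gamma> (drop (length (rep_sorts s)) zs) @ imags_of \<Delta> ws"
    using Cons.prems by (intro Cons.IH) simp
  with Cons.prems show ?case by simp
qed simp

lemma allsorts_split:
  assumes "i < length \<Gamma>"
  shows "allsorts \<Gamma> = allsorts (take i \<Gamma>) @ rep_sorts (\<Gamma> ! i) @ allsorts (drop (Suc i) \<Gamma>)"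
  using arg_cong[OF id_take_nth_drop[OF assms], of "\<lambda>\<Gamma>. allsorts \<Gamma>"] by simp

lemma blockpos_bound:
  assumes "i < length \<Gamma>" shows "offset \<Gamma> i + length (rep_sorts (\<Gamma> ! i)) \<le> length (allsorts \<Gamma>)"
  using arg_cong[OF allsorts_split[OF assms], of length] by (simp add: offset_def)

lemma nth_blockpos:
  assumes "i < length \<Gamma>" shows "map (\<lambda>j. allsorts \<Gamma> ! j) (blockpos \<Gamma> i) = rep_sorts (\<Gamma> ! i)"
  by (subst allsorts_split[OF assms], intro nth_equalityI) (simp_all add: offset_def nth_append)

lemma nth_imags_of:
  assumes "i < length \<Gamma>" "length zs = length (allsorts \<Gamma>)"
  shows "imags_of \<Gamma> zs ! i = imag_of (\<Gamma> ! i) (map (\<lambda>j. zs ! j) (blockpos \<Gamma> i))"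
  using assms
proof (induction \<Gamma> arbitrary: zs i)
  case (Cons s \<Gamma>)
  show ?case
  proof (cases i)
    case 0
    have "take (length (rep_sorts s)) zs = map (\<lambda>j. zs ! j) [0..<length (rep_sorts s)]"
      using Cons.prems by (intro nth_equalityI) auto
    with 0 show ?thesis by (simp add: offset_def)
  next
    case (Suc k)
    let ?l = "length (rep_sorts s)"
    have k: "k < length \<Gamma>" using Cons.prems Suc by simp
    have o: "offset (s # \<Gamma>) (Suc k) = ?l + offset \<Gamma> k" by (simp add: offset_def)
    have "map (\<lambda>j. drop ?l zs ! j) (blockpos \<Gamma> k) = map (\<lambda>j. zs ! j) (blockpos (s # \<Gamma>) (Suc k))"
      using Cons.prems blockpos_bound[OF k] by (intro nth_equalityI) (auto simp: o add.assoc)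
    moreover have "imags_of \<Gamma> (drop ?l zs) ! k = imag_of (\<Gamma> ! k) (map (\<lambda>j. drop ?l zs ! j) (blockpos \<Gamma> k))"
      using Cons.prems Suc by (intro Cons.IH) auto
    ultimately show ?thesis using Suc by simp
  qed
qed simp

lemma imags_of_image: "tuples (eq_struct M) \<Gamma> = imags_of \<Gamma> ` tuples M (allsorts \<Gamma>)"
proof (induction \<Gamma>)
  case Nil
  then show ?case by (auto simp: tuples_def)
next
  case (Cons s \<Gamma>)
  have d: "imags_of (s # \<Gamma>) (xs @ ys) = imag_of s xs # imags_of \<Gamma> ys" if "xs \<in> tuples M (rep_sorts s)" for xs ys
    using tuples_length[OF that] by simp
  show ?case
  proof (intro equalityI subsetI)
    fix us assume "us \<in> tuples (eq_struct M) (s # \<Gamma>)"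
    then obtain xs ys where "us = imag_of s xs # imags_of \<Gamma> ys" "xs \<in> tuples M (rep_sorts s)" "ys \<in> tuples M (allsorts \<Gamma>)"
      by (auto simp: tuples_Cons carr_eq_struct Cons.IH)
    then show "us \<in> imags_of (s # \<Gamma>) ` tuples M (allsorts (s # \<Gamma>))"
      by (intro image_eqI[of _ _ "xs @ ys"]) (simp_all add: d tuples_appendI del: imags_of.simps)
  next
    fix us assume "us \<in> imags_of (s # \<Gamma>) ` tuples M (allsorts (s # \<Gamma>))"
    then obtain xs ys where "us = imag_of s xs # imags_of \<Gamma> ys" "xs \<in> tuples M (rep_sorts s)" "ys \<in> tuples M (allsorts \<Gamma>)"
      by (auto simp: tuples_append d simp del: imags_of.simps)
    then show "us \<in> tuples (eq_struct M) (s # \<Gamma>)"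
      by (simp add: carr_eq_struct Cons.IH)
  qed
qed

lemma imags_of_home:
  assumes "i < length \<Gamma>" "length zs = length (allsorts \<Gamma>)" "\<Gamma> ! i = HomeSort s"
  shows "imags_of \<Gamma> zs ! i = HomeElem (zs ! offset \<Gamma> i)"
  using nth_imags_of[OF assms(1,2)] assms(3) by simp

lemma offset_home:
  assumes "i < length \<Gamma>" "\<Gamma> ! i = HomeSort s"
  shows "offset \<Gamma> i < length (allsorts \<Gamma>)" "allsorts \<Gamma> ! offset \<Gamma> i = s"
  using blockpos_bound[OF assms(1)] nth_blockpos[OF assms(1)] assms(2) by auto

lemma home_positions:
  assumes "\<forall>i\<in>set is. i < length \<Gamma>" "map (\<lambda>i. \<Gamma> ! i) is = map HomeSort ds"
  shows "map (\<lambda>i. allsorts \<Gamma> ! i) (map (offset \<Gamma>) is) = ds"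
    and "\<forall>i\<in>set (map (offset \<Gamma>) is). i < length (allsorts \<Gamma>)"
    and "length zs = length (allsorts \<Gamma>) \<Longrightarrow>
      map (\<lambda>i. imags_of \<Gamma> zs ! i) is = map HomeElem (map (\<lambda>i. zs ! i) (map (offset \<Gamma>) is))"
proof -
  have "map (\<lambda>i. allsorts \<Gamma> ! i) (map (offset \<Gamma>) is) = ds \<and>
    (\<forall>i\<in>set (map (offset \<Gamma>) is). i < length (allsorts \<Gamma>)) \<and>
    (length zs = length (allsorts \<Gamma>) \<longrightarrow>
      map (\<lambda>i. imags_of \<Gamma> zs ! i) is = map HomeElem (map (\<lambda>i. zs ! i) (map (offset \<Gamma>) is)))"
    using assms
  proof (induction "is" arbitrary: ds)
    case (Cons i "is")
    then obtain d ds' where ds: "ds = d # ds'" "\<Gamma> ! i = HomeSort d" "map (\<lambda>i. \<Gamma> ! i) is = map HomeSort ds'"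
      by (cases ds) auto
    have i: "i < length \<Gamma>" using Cons.prems by simp
    show ?case
      using Cons.IH[OF _ ds(3)] Cons.prems(1) offset_home[OF i ds(2)] imags_of_home[OF i _ ds(2)]
      by (simp add: ds(1))
  qed simp
  then show "map (\<lambda>i. allsorts \<Gamma> ! i) (map (offset \<Gamma>) is) = ds"
    and "\<forall>i\<in>set (map (offset \<Gamma>) is). i < length (allsorts \<Gamma>)"
    and "length zs = length (allsorts \<Gamma>) \<Longrightarrow>
      map (\<lambda>i. imags_of \<Gamma> zs ! i) is = map HomeElem (map (\<lambda>i. zs ! i) (map (offset \<Gamma>) is))"
    by blast+
qed

lemma map_HomeElem_eq: "map HomeElem xs = map HomeElem ys \<longleftrightarrow> xs = ys"
  by (intro inj_map_eq_map) (simp add: inj_def)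

lemma dpred_equiv:
  assumes "zero_definable_equiv M ds E" "set \<Gamma> \<subseteq> sorts M"
    "\<forall>i\<in>set (is @ js). i < length \<Gamma>" "map (\<lambda>i. \<Gamma> ! i) is = ds" "map (\<lambda>i. \<Gamma> ! i) js = ds"
  shows "dpred M \<Gamma> (\<lambda>xs. (map (\<lambda>i. xs ! i) is, map (\<lambda>i. xs ! i) js) \<in> E)"
proof -
  let ?A = "{xs @ ys | xs ys. (xs, ys) \<in> E}"
  have E: "E \<subseteq> tuples M ds \<times> tuples M ds"
    using assms(1) by (auto simp: zero_definable_equiv_def equiv_type)
  have "dpred M (ds @ ds) (\<lambda>xs. xs \<in> ?A)"
    using assms(1) unfolding zero_definable_equiv_def by (blast intro: definable_dpred)
  then have "dpred M \<Gamma> (\<lambda>xs. map (\<lambda>i. xs ! i) (is @ js) \<in> ?A)"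
    by (rule dpred_subst) (use assms in auto)
  then show ?thesis
  proof (rule dpred_cong)
    fix xs
    have "length is = length ds" using assms(4) by auto
    moreover have "length a = length ds" if "(a, b) \<in> E" for a b
      using E that tuples_length by blast
    ultimately show "map (\<lambda>i. xs ! i) (is @ js) \<in> ?A \<longleftrightarrow> (map (\<lambda>i. xs ! i) is, map (\<lambda>i. xs ! i) js) \<in> E"
      by fastforce
  qed
qed

text \<open>
  Induction over the formula.  Equality in a quotient sort becomes equivalence of representatives,
  which is definable since only quotients by definable equivalence relations are sorts; a
  projection symbol becomes equivalence, too.  A quantifier over a quotient sort becomes a block of
  quantifiers over representatives.
\<close>

lemma dpred_imags_of_sat:
  assumes "set \<Gamma> \<subseteq> sorts (eq_struct M)" "well_sorted (eq_struct M) \<Gamma> \<phi>"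
  shows "dpred M (allsorts \<Gamma>) (\<lambda>zs. sat (eq_struct M) (imags_of \<Gamma> zs) \<phi>)"
  using assms
proof (induction \<phi> arbitrary: \<Gamma>)
  case (FEq i j)
  then have ij: "i < length \<Gamma>" "j < length \<Gamma>" "\<Gamma> ! i = \<Gamma> ! j" by auto
  note so = allsorts_sorts[OF FEq(1)]
  show ?case
  proof (cases "\<Gamma> ! i")
    case (HomeSort s)
    have "dpred M (allsorts \<Gamma>) (\<lambda>zs. zs ! offset \<Gamma> i = zs ! offset \<Gamma> j)"
      using offset_home[OF ij(1) HomeSort] offset_home[OF ij(2) HomeSort[unfolded ij(3)]]
      by (intro dpred_eq[OF so]) simp_all
    then show ?thesis
      by (rule dpred_cong)
         (simp add: imags_of_home[OF ij(1) _ HomeSort] imags_of_home[OF ij(2) _ HomeSort[unfolded ij(3)]]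
           tuples_length)
  next
    case (QuotSort ds E)
    have "\<Gamma> ! i \<in> sorts (eq_struct M)" using FEq(1) ij by auto
    then have z: "zero_definable_equiv M ds E" using QuotSort by (auto simp: eq_struct_def)
    have Q: "\<Gamma> ! i = QuotSort ds E" "\<Gamma> ! j = QuotSort ds E" using QuotSort ij(3) by simp_all
    have bi: "map (\<lambda>k. allsorts \<Gamma> ! k) (blockpos \<Gamma> i) = ds"
      "\<forall>k\<in>set (blockpos \<Gamma> i). k < length (allsorts \<Gamma>)"
      using nth_blockpos[OF ij(1)] blockpos_bound[OF ij(1)] Q(1) by simp_all
    have bj: "map (\<lambda>k. allsorts \<Gamma> ! k) (blockpos \<Gamma> j) = ds"
      "\<forall>k\<in>set (blockpos \<Gamma> j). k < length (allsorts \<Gamma>)"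
      using nth_blockpos[OF ij(2)] blockpos_bound[OF ij(2)] Q(2) by simp_all
    have "dpred M (allsorts \<Gamma>) (\<lambda>zs. (map (\<lambda>i. zs ! i) (blockpos \<Gamma> i), map (\<lambda>i. zs ! i) (blockpos \<Gamma> j)) \<in> E)"
      by (rule dpred_equiv[OF z so _ bi(1) bj(1)]) (use bi(2) bj(2) in auto)
    then show ?thesis
    proof (rule dpred_cong)
      fix zs assume zs: "zs \<in> tuples M (allsorts \<Gamma>)"
      have "map (\<lambda>i. zs ! i) (blockpos \<Gamma> i) \<in> tuples M ds"
        by (rule tuples_select[OF zs bi(2,1)])
      moreover have "map (\<lambda>i. zs ! i) (blockpos \<Gamma> j) \<in> tuples M ds"
        by (rule tuples_select[OF zs bj(2,1)])
      moreover have "equiv (tuples M ds) E" using z by (simp add: zero_definable_equiv_def)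
      ultimately have "E `` {map (\<lambda>i. zs ! i) (blockpos \<Gamma> i)} = E `` {map (\<lambda>i. zs ! i) (blockpos \<Gamma> j)}
        \<longleftrightarrow> (map (\<lambda>i. zs ! i) (blockpos \<Gamma> i), map (\<lambda>i. zs ! i) (blockpos \<Gamma> j)) \<in> E"
        by (intro eq_equiv_class_iff)
      then show "(map (\<lambda>i. zs ! i) (blockpos \<Gamma> i), map (\<lambda>i. zs ! i) (blockpos \<Gamma> j)) \<in> E
        \<longleftrightarrow> sat (eq_struct M) (imags_of \<Gamma> zs) (FEq i j)"
        by (simp add: nth_imags_of[OF ij(1)] nth_imags_of[OF ij(2)] Q tuples_length[OF zs])
    qed
  qed
next
  case (FRel r "is")
  note so = allsorts_sorts[OF FRel(1)]
  have len: "\<forall>i\<in>set is. i < length \<Gamma>" and ar: "map (\<lambda>i. \<Gamma> ! i) is = eq_arity M r"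
    using FRel by (auto simp: eq_struct_def)
  show ?case
  proof (cases r)
    case (HomeSym q)
    have ar': "map (\<lambda>i. \<Gamma> ! i) is = map HomeSort (arity M q)" using ar HomeSym by simp
    note hp = home_positions[OF len ar']
    have "dpred M (allsorts \<Gamma>) (\<lambda>zs. interp M q (map (\<lambda>i. zs ! i) (map (offset \<Gamma>) is)))"
      by (rule dpred_rel[OF so hp(2,1)])
    then show ?thesis
    proof (rule dpred_cong)
      fix zs assume zs: "zs \<in> tuples M (allsorts \<Gamma>)"
      have "map (\<lambda>i. imags_of \<Gamma> zs ! i) is = map HomeElem (map (\<lambda>i. zs ! i) (map (offset \<Gamma>) is))"
        by (rule hp(3)[OF tuples_length[OF zs]])
      then show "interp M q (map (\<lambda>i. zs ! i) (map (offset \<Gamma>) is)) \<longleftrightarrow>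
          sat (eq_struct M) (imags_of \<Gamma> zs) (FRel r is)"
        using HomeSym by (simp add: eq_struct_def map_HomeElem_eq del: map_map)
    qed
  next
    case (ProjSym ds E)
    have "length is = Suc (length ds)" using arg_cong[OF ar, of length] ProjSym by simp
    then obtain js k where "is": "is = js @ [k]" by (metis length_Suc_conv_rev)
    have js: "map (\<lambda>i. \<Gamma> ! i) js = map HomeSort ds" and k: "\<Gamma> ! k = QuotSort ds E" "k < length \<Gamma>"
      using ar len "is" ProjSym by auto
    have "\<Gamma> ! k \<in> sorts (eq_struct M)"
      by (rule subsetD[OF FRel(1) nth_mem[OF k(2)]])
    then have z: "zero_definable_equiv M ds E" using k by (auto simp: eq_struct_def)
    have "\<forall>i\<in>set js. i < length \<Gamma>" using len "is" by simp
    note hp = home_positions[OF this js]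
    note bk = nth_blockpos[OF k(2)] blockpos_bound[OF k(2)]
    have "dpred M (allsorts \<Gamma>) (\<lambda>zs. (map (\<lambda>i. zs ! i) (map (offset \<Gamma>) js), map (\<lambda>i. zs ! i) (blockpos \<Gamma> k)) \<in> E)"
      by (intro dpred_equiv[OF z so _ hp(1)]) (use hp(2) bk k in auto)
    then show ?thesis
    proof (rule dpred_cong)
      fix zs assume zs: "zs \<in> tuples M (allsorts \<Gamma>)"
      let ?a = "map (\<lambda>i. zs ! i) (map (offset \<Gamma>) js)" and ?b = "map (\<lambda>i. zs ! i) (blockpos \<Gamma> k)"
      have a: "?a \<in> tuples M ds" by (rule tuples_select[OF zs hp(2,1)])
      have b: "?b \<in> tuples M ds" by (rule tuples_select[OF zs]) (use bk k in auto)
      have "map (\<lambda>i. imags_of \<Gamma> zs ! i) js = map HomeElem ?a"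
        by (rule hp(3)[OF tuples_length[OF zs]])
      moreover have "imags_of \<Gamma> zs ! k = ClassElem ds E (E `` {?b})"
        using k by (simp add: nth_imags_of tuples_length[OF zs])
      ultimately have "sat (eq_struct M) (imags_of \<Gamma> zs) (FRel r is) \<longleftrightarrow>
          E `` {?b} = E `` {?a}"
        using ProjSym "is" a by (simp add: eq_struct_def map_HomeElem_eq del: map_map)
      also have "\<dots> \<longleftrightarrow> (?a, ?b) \<in> E"
        using a b z eq_equiv_class_iff[of "tuples M ds" E ?a ?b]
        by (auto simp: zero_definable_equiv_def simp del: map_map)
      finally show "(?a, ?b) \<in> E \<longleftrightarrow> sat (eq_struct M) (imags_of \<Gamma> zs) (FRel r is)" ..
    qed
  qed
next
  case (FNeg \<phi>)
  then show ?case by (auto intro: dpred_not)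
next
  case (FConj \<phi> \<psi>)
  then show ?case by (auto intro: dpred_conj)
next
  case (FEx s \<phi>)
  have "dpred M (allsorts (s # \<Gamma>)) (\<lambda>zs. sat (eq_struct M) (imags_of (s # \<Gamma>) zs) \<phi>)"
    using FEx.prems by (intro FEx.IH) auto
  then have "dpred M (rep_sorts s @ allsorts \<Gamma>) (\<lambda>zs. sat (eq_struct M) (imags_of (s # \<Gamma>) zs) \<phi>)" by simp
  from dpred_exs[OF this] show ?case
    by (rule dpred_cong) (auto simp: carr_eq_struct tuples_length)
qed

text \<open>Parameters in quotient sorts are replaced by parameters representing them.\<close>

lemma dpred_imags_of:
  assumes "dpred (eq_struct M) \<Gamma> P"
  shows "dpred M (allsorts \<Gamma>) (\<lambda>zs. P (imags_of \<Gamma> zs))"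
proof -
  obtain ts ps \<phi> where *: "set ts \<subseteq> sorts (eq_struct M)" "ps \<in> tuples (eq_struct M) ts"
    "well_sorted (eq_struct M) (\<Gamma> @ ts) \<phi>"
    "\<And>xs. xs \<in> tuples (eq_struct M) \<Gamma> \<Longrightarrow> P xs \<longleftrightarrow> sat (eq_struct M) (xs @ ps) \<phi>"
    using assms by (auto simp: dpred_def)
  obtain qs where qs: "qs \<in> tuples M (allsorts ts)" "ps = imags_of ts qs"
    using *(2) by (auto simp: imags_of_image)
  have "dpred M (allsorts (\<Gamma> @ ts)) (\<lambda>zs. sat (eq_struct M) (imags_of (\<Gamma> @ ts) zs) \<phi>)"
    using * dpred_sorts[OF assms] by (intro dpred_imags_of_sat) auto
  then have "dpred M (allsorts \<Gamma>) (\<lambda>zs. sat (eq_struct M) (imags_of (\<Gamma> @ ts) (zs @ qs)) \<phi>)"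
    by (intro dpred_param[where \<Delta> = "allsorts ts"]) (use qs in auto)
  then show ?thesis
    by (rule dpred_cong) (use *(4) qs in \<open>auto simp: imags_of_image imags_of_append tuples_length\<close>)
qed

section \<open>Definability with variables for elements, finite sets and tuples\<close>

abbreviation fieldF :: "('k, 'f) imag_sort" where
  "fieldF \<equiv> HomeSort SortF"

abbreviation inF :: "'f \<Rightarrow> ('k, 'f) imag" where
  "inF B \<equiv> HomeElem (ElemF B)"

fun unK :: "('k, 'f) imag \<Rightarrow> 'k" where
  "unK (HomeElem (ElemK x)) = x"
| "unK _ = undefined"

fun unF :: "('k, 'f) imag \<Rightarrow> 'f" where
  "unF (HomeElem (ElemF B)) = B"
| "unF _ = undefined"

text \<open>
  Besides being the initial value of the recursion, \<open>y0\<close> ensures that the product of the sorts \<open>ss\<close>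
  is nonempty, so that a variable for tuples can always be given a value.
\<close>

locale imaginary_tuples =
  fixes mem :: "'k::field \<Rightarrow> 'f \<Rightarrow> bool"
    and ss :: "('k, 'f) imag_sort list"
    and y0 :: "('k, 'f) imag list"
  assumes char0: "definable_char_zero mem"
    and ss_sorts: "set ss \<subseteq> sorts (eq_struct (kf_struct mem))"
    and y0_tuple: "y0 \<in> tuples (eq_struct (kf_struct mem)) ss"
begin

abbreviation Meq where "Meq \<equiv> eq_struct (kf_struct mem)"
abbreviation T where "T \<equiv> tuples Meq ss"

definition block :: "nat \<Rightarrow> ('k, 'f) imag list \<Rightarrow> ('k, 'f) imag list" where
  "block p xs = map (\<lambda>k. xs ! (p + k)) [0..<length ss]"

text \<open>
  The maps \<open>f\<close>, \<open>g\<close>, \<open>p\<close> assign to each of the variables for elements of \<open>K\<close>, for finite sets and for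
  tuples in \<open>T\<close> its place in the context \<open>\<Gamma>\<close>.  The infinitely many variables of one kind
  share finitely many places.
\<close>

definition places ::
  "('k, 'f) imag_sort list \<Rightarrow> (nat \<Rightarrow> nat) \<Rightarrow> (nat \<Rightarrow> nat) \<Rightarrow> (nat \<Rightarrow> nat) \<Rightarrow> bool" where
  "places \<Gamma> f g p \<longleftrightarrow> set \<Gamma> \<subseteq> sorts Meq \<and>
     (\<forall>i. f i < length \<Gamma> \<and> \<Gamma> ! f i = fieldK \<and> g i < length \<Gamma> \<and> \<Gamma> ! g i = fieldF \<and>
        p i + length ss \<le> length \<Gamma> \<and> (\<forall>k<length ss. \<Gamma> ! (p i + k) = ss ! k))"

text \<open>
  Definability of a predicate of three streams of variables: \<open>\<rho>\<close> for elements of \<open>K\<close>, \<open>\<sigma>\<close> for finite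
  sets and \<open>\<tau>\<close> for tuples in \<open>T\<close>.  Since every placement of the variables is required to work,
  no bound on the variables that occur has to be recorded, and renaming is trivial.  Binding a
  variable shifts one stream, which makes the closure rules below resolvable by unification:
  a HOL formula with typed quantifiers is shown to be definable by applying \<open>dfn_intros\<close>.
\<close>

definition dfn ::
  "((nat \<Rightarrow> 'k) \<Rightarrow> (nat \<Rightarrow> 'f) \<Rightarrow> (nat \<Rightarrow> ('k, 'f) imag list) \<Rightarrow> bool) \<Rightarrow> bool" where
  "dfn P \<longleftrightarrow> (\<forall>\<Gamma> f g p. places \<Gamma> f g p \<longrightarrow>
     dpred Meq \<Gamma> (\<lambda>xs. P (\<lambda>i. unK (xs ! f i)) (\<lambda>i. unF (xs ! g i)) (\<lambda>i. block (p i) xs)))"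

lemma carr_fieldK: "carr Meq fieldK = range inK"
  and carr_fieldF: "carr Meq fieldF = range inF"
  by (auto simp: eq_struct_def kf_struct_def)

lemma home_sorts: "HomeSort s \<in> sorts Meq"
  by (simp add: eq_struct_def kf_struct_def)

lemma places_less: "places \<Gamma> f g p \<Longrightarrow> k < length ss \<Longrightarrow> p i + k < length \<Gamma>"
  unfolding places_def by (meson add_less_cancel_left less_le_trans)

lemma places_append:
  assumes "places \<Gamma> f g p" "set \<Delta> \<subseteq> sorts Meq" shows "places (\<Gamma> @ \<Delta>) f g p"
  using assms places_less[OF assms(1)] by (auto simp: places_def nth_append trans_le_add1 trans_less_add1)

lemma dfnD:
  "dfn P \<Longrightarrow> places \<Gamma> f g p \<Longrightarrow>
     dpred Meq \<Gamma> (\<lambda>xs. P (\<lambda>i. unK (xs ! f i)) (\<lambda>i. unF (xs ! g i)) (\<lambda>i. block (p i) xs))"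
  by (simp add: dfn_def)

lemma block_tuple:
  assumes "places \<Gamma> f g p" "xs \<in> tuples Meq \<Gamma>" shows "block (p i) xs \<in> T"
  unfolding tuples_iff
proof (intro conjI allI impI)
  fix k assume k: "k < length ss"
  have "\<Gamma> ! (p i + k) = ss ! k" using assms(1) k by (simp add: places_def)
  then show "block (p i) xs ! k \<in> carr Meq (ss ! k)"
    using tuples_nth[OF assms(2) places_less[OF assms(1) k, of i]] k by (simp add: block_def)
qed (simp add: block_def)

lemma nth_inK:
  assumes "places \<Gamma> f g p" "xs \<in> tuples Meq \<Gamma>" shows "inK (unK (xs ! f i)) = xs ! f i"
proof -
  have "f i < length \<Gamma>" "\<Gamma> ! f i = fieldK" using assms(1) by (simp_all add: places_def)
  with tuples_nth[OF assms(2), of "f i"] show ?thesis by (auto simp: carr_fieldK)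
qed

lemma nth_inF:
  assumes "places \<Gamma> f g p" "xs \<in> tuples Meq \<Gamma>" shows "inF (unF (xs ! g i)) = xs ! g i"
proof -
  have "g i < length \<Gamma>" "\<Gamma> ! g i = fieldF" using assms(1) by (simp_all add: places_def)
  with tuples_nth[OF assms(2), of "g i"] show ?thesis by (auto simp: carr_fieldF)
qed

lemma dfn_cong:
  assumes "dfn P" "\<And>\<rho> \<sigma> \<tau>. (\<And>i. \<tau> i \<in> T) \<Longrightarrow> P \<rho> \<sigma> \<tau> \<longleftrightarrow> Q \<rho> \<sigma> \<tau>"
  shows "dfn Q"
  unfolding dfn_def
proof (intro allI impI)
  fix \<Gamma> f g p assume pl: "places \<Gamma> f g p"
  show "dpred Meq \<Gamma> (\<lambda>xs. Q (\<lambda>i. unK (xs ! f i)) (\<lambda>i. unF (xs ! g i)) (\<lambda>i. block (p i) xs))"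
    using dfnD[OF assms(1) pl] by (rule dpred_cong) (rule assms(2), rule block_tuple[OF pl])
qed

lemma dfn_not: "dfn P \<Longrightarrow> dfn (\<lambda>\<rho> \<sigma> \<tau>. \<not> P \<rho> \<sigma> \<tau>)"
  by (simp add: dfn_def dpred_not)

lemma dfn_conj: "dfn P \<Longrightarrow> dfn Q \<Longrightarrow> dfn (\<lambda>\<rho> \<sigma> \<tau>. P \<rho> \<sigma> \<tau> \<and> Q \<rho> \<sigma> \<tau>)"
  by (simp add: dfn_def dpred_conj)

lemma dfn_disj:
  assumes "dfn P" "dfn Q" shows "dfn (\<lambda>\<rho> \<sigma> \<tau>. P \<rho> \<sigma> \<tau> \<or> Q \<rho> \<sigma> \<tau>)"
proof -
  have "dfn (\<lambda>\<rho> \<sigma> \<tau>. \<not> (\<not> P \<rho> \<sigma> \<tau> \<and> \<not> Q \<rho> \<sigma> \<tau>))"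
    by (intro dfn_not dfn_conj assms)
  then show ?thesis by (rule dfn_cong) auto
qed

lemma dfn_imp:
  assumes "dfn P" "dfn Q" shows "dfn (\<lambda>\<rho> \<sigma> \<tau>. P \<rho> \<sigma> \<tau> \<longrightarrow> Q \<rho> \<sigma> \<tau>)"
proof -
  have "dfn (\<lambda>\<rho> \<sigma> \<tau>. \<not> P \<rho> \<sigma> \<tau> \<or> Q \<rho> \<sigma> \<tau>)"
    by (intro dfn_not dfn_disj assms)
  then show ?thesis by (rule dfn_cong) auto
qed

lemma dfn_iff:
  assumes "dfn P" "dfn Q" shows "dfn (\<lambda>\<rho> \<sigma> \<tau>. P \<rho> \<sigma> \<tau> \<longleftrightarrow> Q \<rho> \<sigma> \<tau>)"
proof -
  have "dfn (\<lambda>\<rho> \<sigma> \<tau>. (P \<rho> \<sigma> \<tau> \<longrightarrow> Q \<rho> \<sigma> \<tau>) \<and> (Q \<rho> \<sigma> \<tau> \<longrightarrow> P \<rho> \<sigma> \<tau>))"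
    by (intro dfn_imp dfn_conj assms)
  then show ?thesis by (rule dfn_cong) auto
qed

lemma dfn_if:
  assumes "dfn A" "dfn P" "dfn Q" shows "dfn (\<lambda>\<rho> \<sigma> \<tau>. if A \<rho> \<sigma> \<tau> then P \<rho> \<sigma> \<tau> else Q \<rho> \<sigma> \<tau>)"
proof -
  have "dfn (\<lambda>\<rho> \<sigma> \<tau>. (A \<rho> \<sigma> \<tau> \<longrightarrow> P \<rho> \<sigma> \<tau>) \<and> (\<not> A \<rho> \<sigma> \<tau> \<longrightarrow> Q \<rho> \<sigma> \<tau>))"
    by (intro dfn_not dfn_imp dfn_conj assms)
  then show ?thesis by (rule dfn_cong) auto
qed

lemma dfn_rename:
  assumes "dfn P" shows "dfn (\<lambda>\<rho> \<sigma> \<tau>. P (\<lambda>i. \<rho> (a i)) (\<lambda>i. \<sigma> (b i)) (\<lambda>i. \<tau> (c i)))"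
  unfolding dfn_def
proof (intro allI impI)
  fix \<Gamma> f g p assume "places \<Gamma> f g p"
  then have "places \<Gamma> (\<lambda>i. f (a i)) (\<lambda>i. g (b i)) (\<lambda>i. p (c i))" by (simp add: places_def)
  from dfnD[OF assms this]
  show "dpred Meq \<Gamma> (\<lambda>xs. P (\<lambda>i. unK (xs ! f (a i))) (\<lambda>i. unF (xs ! g (b i))) (\<lambda>i. block (p (c i)) xs))" .
qed

lemma block_Cons: "block (Suc p) (x # xs) = block p xs"
  by (simp add: block_def)

lemma block_append: "block (length ys + p) (ys @ xs) = block p xs"
  by (simp add: block_def add.assoc)

lemma block_append1: "p + length ss \<le> length xs \<Longrightarrow> block p (xs @ ys) = block p xs"
  by (auto simp: block_def nth_append)

lemma block_0: "length y = length ss \<Longrightarrow> block 0 (y @ xs) = y"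
  by (auto simp: block_def nth_append intro: nth_equalityI)

lemma dfn_exK:
  assumes "dfn (\<lambda>\<rho> \<sigma> \<tau>. P (\<rho> 0) (\<lambda>i. \<rho> (Suc i)) \<sigma> \<tau>)"
  shows "dfn (\<lambda>\<rho> \<sigma> \<tau>. \<exists>x. P x \<rho> \<sigma> \<tau>)"
  unfolding dfn_def
proof (intro allI impI)
  fix \<Gamma> f g p assume pl: "places \<Gamma> f g p"
  then have pl2: "places (fieldK # \<Gamma>) (case_nat 0 (\<lambda>i. Suc (f i))) (\<lambda>i. Suc (g i)) (\<lambda>i. Suc (p i))"
    by (auto simp: places_def home_sorts split: nat.split)
  from dfnD[OF assms pl2] have "dpred Meq (fieldK # \<Gamma>) (\<lambda>xs. P (unK (xs ! 0))
      (\<lambda>i. unK (xs ! Suc (f i))) (\<lambda>i. unF (xs ! Suc (g i))) (\<lambda>i. block (Suc (p i)) xs))"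
    by simp
  from dpred_ex[OF this]
  show "dpred Meq \<Gamma> (\<lambda>xs. \<exists>x. P x (\<lambda>i. unK (xs ! f i)) (\<lambda>i. unF (xs ! g i)) (\<lambda>i. block (p i) xs))"
    by (rule dpred_cong) (simp add: carr_fieldK block_Cons)
qed

lemma dfn_exF:
  assumes "dfn (\<lambda>\<rho> \<sigma> \<tau>. P (\<sigma> 0) \<rho> (\<lambda>i. \<sigma> (Suc i)) \<tau>)"
  shows "dfn (\<lambda>\<rho> \<sigma> \<tau>. \<exists>x. P x \<rho> \<sigma> \<tau>)"
  unfolding dfn_def
proof (intro allI impI)
  fix \<Gamma> f g p assume pl: "places \<Gamma> f g p"
  then have pl2: "places (fieldF # \<Gamma>) (\<lambda>i. Suc (f i)) (case_nat 0 (\<lambda>i. Suc (g i))) (\<lambda>i. Suc (p i))"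
    by (auto simp: places_def home_sorts split: nat.split)
  from dfnD[OF assms pl2] have "dpred Meq (fieldF # \<Gamma>) (\<lambda>xs. P (unF (xs ! 0))
      (\<lambda>i. unK (xs ! Suc (f i))) (\<lambda>i. unF (xs ! Suc (g i))) (\<lambda>i. block (Suc (p i)) xs))"
    by simp
  from dpred_ex[OF this]
  show "dpred Meq \<Gamma> (\<lambda>xs. \<exists>x. P x (\<lambda>i. unK (xs ! f i)) (\<lambda>i. unF (xs ! g i)) (\<lambda>i. block (p i) xs))"
    by (rule dpred_cong) (simp add: carr_fieldF block_Cons)
qed

lemma dfn_exT:
  assumes "dfn (\<lambda>\<rho> \<sigma> \<tau>. P (\<tau> 0) \<rho> \<sigma> (\<lambda>i. \<tau> (Suc i)))"
  shows "dfn (\<lambda>\<rho> \<sigma> \<tau>. \<exists>y\<in>T. P y \<rho> \<sigma> \<tau>)"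
  unfolding dfn_def
proof (intro allI impI)
  fix \<Gamma> f g p assume pl: "places \<Gamma> f g p"
  let ?l = "length ss"
  have "?l + p i \<le> length \<Gamma>" for i
    using pl unfolding places_def by (metis add.commute)
  then have pl2: "places (ss @ \<Gamma>) (\<lambda>i. ?l + f i) (\<lambda>i. ?l + g i) (case_nat 0 (\<lambda>i. ?l + p i))"
    using pl ss_sorts
    by (auto simp: places_def nth_append add.assoc split: nat.split)
  from dfnD[OF assms pl2] have "dpred Meq (ss @ \<Gamma>) (\<lambda>xs. P (block 0 xs)
      (\<lambda>i. unK (xs ! (?l + f i))) (\<lambda>i. unF (xs ! (?l + g i))) (\<lambda>i. block (?l + p i) xs))"
    by simp
  from dpred_exs[OF this]
  show "dpred Meq \<Gamma> (\<lambda>xs. \<exists>y\<in>T. P y (\<lambda>i. unK (xs ! f i)) (\<lambda>i. unF (xs ! g i)) (\<lambda>i. block (p i) xs))"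
  proof (rule dpred_cong)
    fix xs
    have "P (block 0 (y @ xs)) (\<lambda>i. unK ((y @ xs) ! (?l + f i))) (\<lambda>i. unF ((y @ xs) ! (?l + g i)))
        (\<lambda>i. block (?l + p i) (y @ xs))
      \<longleftrightarrow> P y (\<lambda>i. unK (xs ! f i)) (\<lambda>i. unF (xs ! g i)) (\<lambda>i. block (p i) xs)" if "y \<in> T" for y
      using tuples_length[OF that] block_append[of y] by (simp add: block_0 nth_append)
    then show "(\<exists>y\<in>T. P (block 0 (y @ xs)) (\<lambda>i. unK ((y @ xs) ! (?l + f i)))
        (\<lambda>i. unF ((y @ xs) ! (?l + g i))) (\<lambda>i. block (?l + p i) (y @ xs)))
      \<longleftrightarrow> (\<exists>y\<in>T. P y (\<lambda>i. unK (xs ! f i)) (\<lambda>i. unF (xs ! g i)) (\<lambda>i. block (p i) xs))"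
      by blast
  qed
qed

lemma dfn_allK:
  assumes "dfn (\<lambda>\<rho> \<sigma> \<tau>. P (\<rho> 0) (\<lambda>i. \<rho> (Suc i)) \<sigma> \<tau>)"
  shows "dfn (\<lambda>\<rho> \<sigma> \<tau>. \<forall>x. P x \<rho> \<sigma> \<tau>)"
proof -
  have "dfn (\<lambda>\<rho> \<sigma> \<tau>. \<not> (\<exists>x. \<not> P x \<rho> \<sigma> \<tau>))"
    by (intro dfn_not dfn_exK assms)
  then show ?thesis by simp
qed

lemma dfn_allF:
  assumes "dfn (\<lambda>\<rho> \<sigma> \<tau>. P (\<sigma> 0) \<rho> (\<lambda>i. \<sigma> (Suc i)) \<tau>)"
  shows "dfn (\<lambda>\<rho> \<sigma> \<tau>. \<forall>x. P x \<rho> \<sigma> \<tau>)"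
proof -
  have "dfn (\<lambda>\<rho> \<sigma> \<tau>. \<not> (\<exists>x. \<not> P x \<rho> \<sigma> \<tau>))"
    by (intro dfn_not dfn_exF assms)
  then show ?thesis by simp
qed

lemma dfn_allT:
  assumes "dfn (\<lambda>\<rho> \<sigma> \<tau>. P (\<tau> 0) \<rho> \<sigma> (\<lambda>i. \<tau> (Suc i)))"
  shows "dfn (\<lambda>\<rho> \<sigma> \<tau>. \<forall>y\<in>T. P y \<rho> \<sigma> \<tau>)"
proof -
  have "dfn (\<lambda>\<rho> \<sigma> \<tau>. \<not> (\<exists>x\<in>T. \<not> P x \<rho> \<sigma> \<tau>))"
    by (intro dfn_not dfn_exT assms)
  then show ?thesis by simp
qed

text \<open>Instantiation by a parameter, which is placed at the end of the context.\<close>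

lemma dfn_instK:
  assumes "dfn (\<lambda>\<rho> \<sigma> \<tau>. P (\<rho> 0) (\<lambda>i. \<rho> (Suc i)) \<sigma> \<tau>)"
  shows "dfn (\<lambda>\<rho> \<sigma> \<tau>. P c \<rho> \<sigma> \<tau>)"
  unfolding dfn_def
proof (intro allI impI)
  fix \<Gamma> f g p assume pl: "places \<Gamma> f g p"
  then have pl2: "places (\<Gamma> @ [fieldK]) (case_nat (length \<Gamma>) f) g p"
    using places_append[OF pl, of "[fieldK]"] by (auto simp: places_def home_sorts split: nat.split)
  from dfnD[OF assms pl2] have "dpred Meq (\<Gamma> @ [fieldK]) (\<lambda>xs. P (unK (xs ! length \<Gamma>))
      (\<lambda>i. unK (xs ! f i)) (\<lambda>i. unF (xs ! g i)) (\<lambda>i. block (p i) xs))"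
    by simp
  from dpred_param[OF this, of "[inK c]"]
  have "dpred Meq \<Gamma> (\<lambda>xs. P (unK ((xs @ [inK c]) ! length \<Gamma>)) (\<lambda>i. unK ((xs @ [inK c]) ! f i))
      (\<lambda>i. unF ((xs @ [inK c]) ! g i)) (\<lambda>i. block (p i) (xs @ [inK c])))"
    by (simp add: carr_fieldK)
  then show "dpred Meq \<Gamma> (\<lambda>xs. P c (\<lambda>i. unK (xs ! f i)) (\<lambda>i. unF (xs ! g i)) (\<lambda>i. block (p i) xs))"
    by (rule dpred_cong)
       (use pl in \<open>simp add: tuples_length nth_append block_append1 places_def\<close>)
qed

lemma dfn_instF:
  assumes "dfn (\<lambda>\<rho> \<sigma> \<tau>. P (\<sigma> 0) \<rho> (\<lambda>i. \<sigma> (Suc i)) \<tau>)"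
  shows "dfn (\<lambda>\<rho> \<sigma> \<tau>. P c \<rho> \<sigma> \<tau>)"
  unfolding dfn_def
proof (intro allI impI)
  fix \<Gamma> f g p assume pl: "places \<Gamma> f g p"
  then have pl2: "places (\<Gamma> @ [fieldF]) f (case_nat (length \<Gamma>) g) p"
    using places_append[OF pl, of "[fieldF]"] by (auto simp: places_def home_sorts split: nat.split)
  from dfnD[OF assms pl2] have "dpred Meq (\<Gamma> @ [fieldF]) (\<lambda>xs. P (unF (xs ! length \<Gamma>))
      (\<lambda>i. unK (xs ! f i)) (\<lambda>i. unF (xs ! g i)) (\<lambda>i. block (p i) xs))"
    by simp
  from dpred_param[OF this, of "[inF c]"]
  have "dpred Meq \<Gamma> (\<lambda>xs. P (unF ((xs @ [inF c]) ! length \<Gamma>)) (\<lambda>i. unK ((xs @ [inF c]) ! f i))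
      (\<lambda>i. unF ((xs @ [inF c]) ! g i)) (\<lambda>i. block (p i) (xs @ [inF c])))"
    by (simp add: carr_fieldF)
  then show "dpred Meq \<Gamma> (\<lambda>xs. P c (\<lambda>i. unK (xs ! f i)) (\<lambda>i. unF (xs ! g i)) (\<lambda>i. block (p i) xs))"
    by (rule dpred_cong)
       (use pl in \<open>simp add: tuples_length nth_append block_append1 places_def\<close>)
qed

lemma interp_PlusSym:
  "interp Meq (HomeSym PlusSym) [inK x, inK y, inK z] \<longleftrightarrow> z = x + y"
  by (auto simp: eq_struct_def kf_struct_def Cons_eq_map_conv)

lemma interp_TimesSym:
  "interp Meq (HomeSym TimesSym) [inK x, inK y, inK z] \<longleftrightarrow> z = x * y"
  by (auto simp: eq_struct_def kf_struct_def Cons_eq_map_conv)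

lemma interp_MemSym: "interp Meq (HomeSym MemSym) [inK x, inF B] \<longleftrightarrow> mem x B"
  by (auto simp: eq_struct_def kf_struct_def Cons_eq_map_conv)

lemma dfn_plus: "dfn (\<lambda>\<rho> \<sigma> \<tau>. \<rho> k = \<rho> i + \<rho> j)"
  unfolding dfn_def
proof (intro allI impI)
  fix \<Gamma> f g p assume pl: "places \<Gamma> f g p"
  have "dpred Meq \<Gamma> (\<lambda>xs. interp Meq (HomeSym PlusSym) (map (\<lambda>i. xs ! i) [f i, f j, f k]))"
    using pl by (intro dpred_rel) (auto simp: places_def eq_struct_def kf_struct_def)
  then show "dpred Meq \<Gamma> (\<lambda>xs. unK (xs ! f k) = unK (xs ! f i) + unK (xs ! f j))"
  proof (rule dpred_cong)
    fix xs assume xs: "xs \<in> tuples Meq \<Gamma>"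
    show "interp Meq (HomeSym PlusSym) (map (\<lambda>i. xs ! i) [f i, f j, f k]) \<longleftrightarrow>
      unK (xs ! f k) = unK (xs ! f i) + unK (xs ! f j)"
      using interp_PlusSym[of "unK (xs ! f i)" "unK (xs ! f j)" "unK (xs ! f k)"]
      by (simp add: nth_inK[OF pl xs, of i] nth_inK[OF pl xs, of j] nth_inK[OF pl xs, of k])
  qed
qed

lemma dfn_times: "dfn (\<lambda>\<rho> \<sigma> \<tau>. \<rho> k = \<rho> i * \<rho> j)"
  unfolding dfn_def
proof (intro allI impI)
  fix \<Gamma> f g p assume pl: "places \<Gamma> f g p"
  have "dpred Meq \<Gamma> (\<lambda>xs. interp Meq (HomeSym TimesSym) (map (\<lambda>i. xs ! i) [f i, f j, f k]))"
    using pl by (intro dpred_rel) (auto simp: places_def eq_struct_def kf_struct_def)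
  then show "dpred Meq \<Gamma> (\<lambda>xs. unK (xs ! f k) = unK (xs ! f i) * unK (xs ! f j))"
  proof (rule dpred_cong)
    fix xs assume xs: "xs \<in> tuples Meq \<Gamma>"
    show "interp Meq (HomeSym TimesSym) (map (\<lambda>i. xs ! i) [f i, f j, f k]) \<longleftrightarrow>
      unK (xs ! f k) = unK (xs ! f i) * unK (xs ! f j)"
      using interp_TimesSym[of "unK (xs ! f i)" "unK (xs ! f j)" "unK (xs ! f k)"]
      by (simp add: nth_inK[OF pl xs, of i] nth_inK[OF pl xs, of j] nth_inK[OF pl xs, of k])
  qed
qed

lemma dfn_mem_var: "dfn (\<lambda>\<rho> \<sigma> \<tau>. mem (\<rho> i) (\<sigma> j))"
  unfolding dfn_def
proof (intro allI impI)
  fix \<Gamma> f g p assume pl: "places \<Gamma> f g p"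
  have "dpred Meq \<Gamma> (\<lambda>xs. interp Meq (HomeSym MemSym) (map (\<lambda>i. xs ! i) [f i, g j]))"
    using pl by (intro dpred_rel) (auto simp: places_def eq_struct_def kf_struct_def)
  then show "dpred Meq \<Gamma> (\<lambda>xs. mem (unK (xs ! f i)) (unF (xs ! g j)))"
  proof (rule dpred_cong)
    fix xs assume xs: "xs \<in> tuples Meq \<Gamma>"
    show "interp Meq (HomeSym MemSym) (map (\<lambda>i. xs ! i) [f i, g j]) \<longleftrightarrow>
      mem (unK (xs ! f i)) (unF (xs ! g j))"
      using interp_MemSym[of "unK (xs ! f i)" "unF (xs ! g j)"]
      by (simp add: nth_inK[OF pl xs, of i] nth_inF[OF pl xs, of j])
  qed
qed

lemma dfn_var_eq: "dfn (\<lambda>\<rho> \<sigma> \<tau>. \<rho> i = \<rho> j)"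
  unfolding dfn_def
proof (intro allI impI)
  fix \<Gamma> f g p assume pl: "places \<Gamma> f g p"
  have "dpred Meq \<Gamma> (\<lambda>xs. xs ! f i = xs ! f j)"
    using pl by (intro dpred_eq) (auto simp: places_def)
  then show "dpred Meq \<Gamma> (\<lambda>xs. unK (xs ! f i) = unK (xs ! f j))"
    proof (rule dpred_cong)
    fix xs assume xs: "xs \<in> tuples Meq \<Gamma>"
    show "xs ! f i = xs ! f j \<longleftrightarrow> unK (xs ! f i) = unK (xs ! f j)"
    proof
      assume "unK (xs ! f i) = unK (xs ! f j)"
      then have "(inK (unK (xs ! f i)) :: ('k, 'f) imag) = inK (unK (xs ! f j))" by (rule arg_cong)
      then show "xs ! f i = xs ! f j" unfolding nth_inK[OF pl xs] .
    qed simp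
  qed
qed

text \<open>A definable relation on \<open>K \<times> T \<times> T\<close>, such as the graph of \<open>h\<close>, may serve as an atomic formula.\<close>

lemma dfn_definable3:
  assumes "dpred Meq (fieldK # ss @ ss) A"
  shows "dfn (\<lambda>\<rho> \<sigma> \<tau>. A (inK (\<rho> i) # \<tau> j @ \<tau> l))"
  unfolding dfn_def
proof (intro allI impI)
  fix \<Gamma> f g p assume pl: "places \<Gamma> f g p"
  let ?is = "f i # map (\<lambda>k. p j + k) [0..<length ss] @ map (\<lambda>k. p l + k) [0..<length ss]"
  have block: "map (\<lambda>k. \<Gamma> ! (p j + k)) [0..<length ss] = ss" for j
    using pl by (intro nth_equalityI) (simp_all add: places_def)
  have "map (\<lambda>k. \<Gamma> ! k) ?is = fieldK # ss @ ss"
    using pl by (simp add: o_def block) (simp add: places_def)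
  moreover have le: "f i < length \<Gamma>" "p j + length ss \<le> length \<Gamma>" "p l + length ss \<le> length \<Gamma>"
    "set \<Gamma> \<subseteq> sorts Meq"
    using pl by (simp_all add: places_def)
  have "\<forall>k\<in>set ?is. k < length \<Gamma>" using le(1-3) by auto
  moreover note le(4)
  ultimately have "dpred Meq \<Gamma> (\<lambda>xs. A (map (\<lambda>k. xs ! k) ?is))"
    by (intro dpred_subst[OF assms])
  then show "dpred Meq \<Gamma> (\<lambda>xs. A (inK (unK (xs ! f i)) # block (p j) xs @ block (p l) xs))"
    by (rule dpred_cong) (simp add: block_def o_def nth_inK[OF pl])
qed

text \<open>Definable functions with values in \<open>K\<close>, given by their graph.\<close>

definition trm :: "((nat \<Rightarrow> 'k) \<Rightarrow> (nat \<Rightarrow> 'f) \<Rightarrow> (nat \<Rightarrow> ('k, 'f) imag list) \<Rightarrow> 'k) \<Rightarrow> bool" where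
  "trm t \<longleftrightarrow> dfn (\<lambda>\<rho> \<sigma> \<tau>. \<rho> 0 = t (\<lambda>i. \<rho> (Suc i)) \<sigma> \<tau>)"

text \<open>
  Definable functions with values in \<open>F(K)\<close>, given by the membership relation of the value;
  this determines the value by extensionality.
\<close>

definition set_trm :: "((nat \<Rightarrow> 'k) \<Rightarrow> (nat \<Rightarrow> 'f) \<Rightarrow> (nat \<Rightarrow> ('k, 'f) imag list) \<Rightarrow> 'f) \<Rightarrow> bool" where
  "set_trm s \<longleftrightarrow> dfn (\<lambda>\<rho> \<sigma> \<tau>. mem (\<rho> 0) (s (\<lambda>i. \<rho> (Suc i)) \<sigma> \<tau>))"

lemma dfn_trm:
  assumes "trm t"
  shows "dfn (\<lambda>\<rho> \<sigma> \<tau>. \<rho> j = t (\<lambda>i. \<rho> (a i)) (\<lambda>i. \<sigma> (b i)) (\<lambda>i. \<tau> (c i)))"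
  using dfn_rename[OF assms[unfolded trm_def], of "case_nat j a" b c] by simp

lemma dfn_set_trm:
  assumes "set_trm s"
  shows "dfn (\<lambda>\<rho> \<sigma> \<tau>. mem (\<rho> j) (s (\<lambda>i. \<rho> (a i)) (\<lambda>i. \<sigma> (b i)) (\<lambda>i. \<tau> (c i))))"
  using dfn_rename[OF assms[unfolded set_trm_def], of "case_nat j a" b c] by simp

text \<open>A term is substituted for a variable by quantifying over its value.\<close>

lemma dfn_let:
  assumes "trm t" "dfn (\<lambda>\<rho> \<sigma> \<tau>. P (\<rho> 0) (\<lambda>i. \<rho> (Suc i)) \<sigma> \<tau>)"
  shows "dfn (\<lambda>\<rho> \<sigma> \<tau>. P (t \<rho> \<sigma> \<tau>) \<rho> \<sigma> \<tau>)"
proof -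
  have "dfn (\<lambda>\<rho> \<sigma> \<tau>. \<exists>x. x = t \<rho> \<sigma> \<tau> \<and> P x \<rho> \<sigma> \<tau>)"
    by (intro dfn_exK dfn_conj assms(2) assms(1)[unfolded trm_def])
  then show ?thesis by simp
qed

lemma trm_var: "trm (\<lambda>\<rho> \<sigma> \<tau>. \<rho> i)"
  unfolding trm_def by (rule dfn_var_eq)

lemma trm_const: "trm (\<lambda>\<rho> \<sigma> \<tau>. c)"
  unfolding trm_def by (rule dfn_instK[where P = "\<lambda>c \<rho> \<sigma> \<tau>. \<rho> 0 = c"]) (rule dfn_var_eq)

lemma trm_plus: "trm t \<Longrightarrow> trm u \<Longrightarrow> trm (\<lambda>\<rho> \<sigma> \<tau>. t \<rho> \<sigma> \<tau> + u \<rho> \<sigma> \<tau>)"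
proof -
  assume "trm t" "trm u"
  then have "dfn (\<lambda>\<rho> \<sigma> \<tau>. \<exists>x y. \<rho> 0 = x + y \<and> x = t (\<lambda>i. \<rho> (Suc i)) \<sigma> \<tau> \<and> y = u (\<lambda>i. \<rho> (Suc i)) \<sigma> \<tau>)"
    by (intro dfn_exK dfn_conj dfn_plus dfn_trm)
  then show ?thesis by (simp add: trm_def)
qed

lemma trm_times: "trm t \<Longrightarrow> trm u \<Longrightarrow> trm (\<lambda>\<rho> \<sigma> \<tau>. t \<rho> \<sigma> \<tau> * u \<rho> \<sigma> \<tau>)"
proof -
  assume "trm t" "trm u"
  then have "dfn (\<lambda>\<rho> \<sigma> \<tau>. \<exists>x y. \<rho> 0 = x * y \<and> x = t (\<lambda>i. \<rho> (Suc i)) \<sigma> \<tau> \<and> y = u (\<lambda>i. \<rho> (Suc i)) \<sigma> \<tau>)"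
    by (intro dfn_exK dfn_conj dfn_times dfn_trm)
  then show ?thesis by (simp add: trm_def)
qed

lemma trm_minus: "trm t \<Longrightarrow> trm u \<Longrightarrow> trm (\<lambda>\<rho> \<sigma> \<tau>. t \<rho> \<sigma> \<tau> - u \<rho> \<sigma> \<tau>)"
proof -
  assume "trm t" "trm u"
  then have "trm (\<lambda>\<rho> \<sigma> \<tau>. t \<rho> \<sigma> \<tau> + (- 1) * u \<rho> \<sigma> \<tau>)"
    by (intro trm_plus trm_times trm_const)
  then show ?thesis by simp
qed

lemma set_trm_var: "set_trm (\<lambda>\<rho> \<sigma> \<tau>. \<sigma> i)"
  unfolding set_trm_def by (rule dfn_mem_var)

lemma set_trm_const: "set_trm (\<lambda>\<rho> \<sigma> \<tau>. B)"
  unfolding set_trm_def by (rule dfn_instF[where P = "\<lambda>B \<rho> \<sigma> \<tau>. mem (\<rho> 0) B"]) (rule dfn_mem_var)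

lemma dfn_eq:
  assumes "trm t" "trm u" shows "dfn (\<lambda>\<rho> \<sigma> \<tau>. t \<rho> \<sigma> \<tau> = u \<rho> \<sigma> \<tau>)"
  by (rule dfn_let[OF assms(1), where P = "\<lambda>x \<rho> \<sigma> \<tau>. x = u \<rho> \<sigma> \<tau>"]) (rule assms(2)[unfolded trm_def])

lemma dfn_mem:
  assumes "trm t" "set_trm s" shows "dfn (\<lambda>\<rho> \<sigma> \<tau>. mem (t \<rho> \<sigma> \<tau>) (s \<rho> \<sigma> \<tau>))"
  by (rule dfn_let[OF assms(1), where P = "\<lambda>x \<rho> \<sigma> \<tau>. mem x (s \<rho> \<sigma> \<tau>)"]) (rule assms(2)[unfolded set_trm_def])

lemmas dfn_intros =
  dfn_not dfn_conj dfn_disj dfn_imp dfn_iff dfn_if dfn_exK dfn_exF dfn_exT dfn_allK dfn_allF dfn_allT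
  dfn_eq dfn_mem trm_var trm_const trm_plus trm_times trm_minus set_trm_var set_trm_const

lemma dfn_rel1:
  assumes "dfn (\<lambda>\<rho> \<sigma> \<tau>. R (\<rho> 0))" "trm t" shows "dfn (\<lambda>\<rho> \<sigma> \<tau>. R (t \<rho> \<sigma> \<tau>))"
  using assms by (rule dfn_let[rotated])

lemma dfn_rel2:
  assumes "dfn (\<lambda>\<rho> \<sigma> \<tau>. R (\<rho> 0) (\<rho> 1))" "trm t" "trm u"
  shows "dfn (\<lambda>\<rho> \<sigma> \<tau>. R (t \<rho> \<sigma> \<tau>) (u \<rho> \<sigma> \<tau>))"
proof -
  have "dfn (\<lambda>\<rho> \<sigma> \<tau>. \<exists>x y. R x y \<and> x = t \<rho> \<sigma> \<tau> \<and> y = u \<rho> \<sigma> \<tau>)"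
    using dfn_rename[OF assms(1), of "case_nat 1 (\<lambda>_. 0)"]
    by (intro dfn_exK dfn_conj dfn_trm assms) simp
  then show ?thesis by simp
qed

lemma dfn_NN: "trm t \<Longrightarrow> dfn (\<lambda>\<rho> \<sigma> \<tau>. t \<rho> \<sigma> \<tau> \<in> K0 mem)"
proof (rule dfn_rel1)
  have "dfn (\<lambda>\<rho> \<sigma> \<tau>. \<exists>F. mem (\<rho> 0) F \<and> (\<forall>z. mem z F \<longrightarrow> \<not> z = 0 \<longrightarrow> mem (z - 1) F))"
    by (intro dfn_intros)
  then show "dfn (\<lambda>\<rho> \<sigma> \<tau>. \<rho> 0 \<in> K0 mem)" by (simp add: K0_def)
qed

section \<open>Pseudofinite sets\<close>

text \<open>Variables of the other two kinds are given parameters as values before imaginaries are eliminated.\<close>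

lemma dfn_dpred_F:
  assumes "dfn (\<lambda>\<rho> \<sigma> \<tau>. U (\<sigma> 0))"
  shows "definable (kf_struct mem) [SortF] {[ElemF B] | B. U B}"
proof -
  let ?\<Gamma> = "[fieldF] @ fieldK # ss"
  have pl: "places ?\<Gamma> (\<lambda>_. 1) (\<lambda>_. 0) (\<lambda>_. 2)"
    using ss_sorts by (auto simp: places_def home_sorts)
  from dfnD[OF assms pl] have "dpred Meq ?\<Gamma> (\<lambda>xs. U (unF (xs ! 0)))"
    by simp
  from dpred_param[OF this, of "inK 0 # y0"]
  have "dpred Meq [fieldF] (\<lambda>xs. U (unF ((xs @ inK 0 # y0) ! 0)))"
    by (simp add: y0_tuple carr_fieldK)
  from dpred_definable[OF dpred_imags_of[OF this]]
  have "definable (kf_struct mem) [SortF]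
      {zs \<in> tuples (kf_struct mem) [SortF]. U (unF ((imags_of [fieldF] zs @ inK 0 # y0) ! 0))}"
    by simp
  also have "{zs \<in> tuples (kf_struct mem) [SortF]. U (unF ((imags_of [fieldF] zs @ inK 0 # y0) ! 0))}
      = {[ElemF B] | B. U B}"
    by (auto simp: tuples_Cons kf_struct_def)
  finally show ?thesis .
qed

text \<open>
  By elimination of imaginaries, induction over \<open>F(K)\<close> is available for every property that satisfies
  \<open>dfn\<close>, thus with imaginary parameters and quantifiers over imaginaries.
\<close>

lemma powerset_axioms:
  shows F_ext: "(\<And>x. mem x B \<longleftrightarrow> mem x C) \<Longrightarrow> B = C"
    and F_empty: "\<exists>E. \<forall>x. \<not> mem x E"
    and F_single: "\<exists>S. \<forall>x. mem x S \<longleftrightarrow> x = a"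
    and F_union: "\<exists>D. \<forall>x. mem x D \<longleftrightarrow> mem x B \<or> mem x C"
    and F_induct: "\<lbrakk>dfn (\<lambda>\<rho> \<sigma> \<tau>. U (\<sigma> 0)); \<And>E. (\<And>x. \<not> mem x E) \<Longrightarrow> U E;
      \<And>B x C. U B \<Longrightarrow> (\<And>z. mem z C \<longleftrightarrow> mem z B \<or> z = x) \<Longrightarrow> U C\<rbrakk> \<Longrightarrow> U B"
proof -
  define X :: "('k, 'f) kf_elem list set" where "X = {[ElemK x] | x. True}"
  define Y :: "('k, 'f) kf_elem list set" where "Y = {[ElemF B] | B. True}"
  define mm :: "('k, 'f) kf_elem list \<Rightarrow> ('k, 'f) kf_elem list \<Rightarrow> bool"
    where "mm us vs \<longleftrightarrow> (\<exists>x B. us = [ElemK x] \<and> vs = [ElemF B] \<and> mem x B)" for us vs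
  have "definable_finite_powerset (kf_struct mem) [SortK] X [SortF] Y mm"
    using char0 unfolding definable_char_zero_def has_finite_powerset_def X_def Y_def mm_def by blast
  then have ax: "\<forall>B\<in>Y. \<forall>C\<in>Y. B = C \<longleftrightarrow> (\<forall>x\<in>X. mm x B \<longleftrightarrow> mm x C)"
    "\<exists>e\<in>Y. \<forall>x\<in>X. \<not> mm x e" "\<forall>a\<in>X. \<exists>s\<in>Y. \<forall>x\<in>X. mm x s \<longleftrightarrow> x = a"
    "\<forall>B\<in>Y. \<forall>C\<in>Y. \<exists>D\<in>Y. \<forall>x\<in>X. mm x D \<longleftrightarrow> mm x B \<or> mm x C"
    "\<And>U. U \<subseteq> Y \<Longrightarrow> definable (kf_struct mem) [SortF] U \<Longrightarrow> star_empty X Y mm \<in> U \<Longrightarrow>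
          (\<forall>B\<in>U. \<forall>x\<in>X. star_union X Y mm B (star_single X Y mm x) \<in> U) \<Longrightarrow> U = Y"
    unfolding definable_finite_powerset_def by blast+
  have mm: "mm [ElemK x] [ElemF B] \<longleftrightarrow> mem x B" for x B by (simp add: mm_def)
  have X: "(\<forall>u\<in>X. Q u) \<longleftrightarrow> (\<forall>x. Q [ElemK x])" for Q by (auto simp: X_def)
  have Y: "(\<forall>u\<in>Y. Q u) \<longleftrightarrow> (\<forall>x. Q [ElemF x])" "(\<exists>u\<in>Y. Q u) \<longleftrightarrow> (\<exists>x. Q [ElemF x])" for Q
    by (auto simp: Y_def)
  note ax' = ax(1-4)[unfolded X Y mm, simplified]
  show ext: "B = C" if "\<And>x. mem x B \<longleftrightarrow> mem x C" for B C using ax'(1) that by blast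
  show "\<exists>E. \<forall>x. \<not> mem x E" "\<exists>S. \<forall>x. mem x S \<longleftrightarrow> x = a"
    "\<exists>D. \<forall>x. mem x D \<longleftrightarrow> mem x B \<or> mem x C" for a B C using ax' by blast+
  have char: "(THE e. e \<in> Y \<and> (\<forall>x\<in>X. mm x e \<longleftrightarrow> Q x)) = [ElemF B]"
    if "\<And>x. mem x B \<longleftrightarrow> Q [ElemK x]" for Q B
    by (rule the_equality) (use that in \<open>auto simp: X mm Y_def intro: ext\<close>)
  show "U B" if U: "dfn (\<lambda>\<rho> \<sigma> \<tau>. U (\<sigma> 0))" and e: "\<And>E. (\<And>x. \<not> mem x E) \<Longrightarrow> U E"
    and i: "\<And>B x C. U B \<Longrightarrow> (\<And>z. mem z C \<longleftrightarrow> mem z B \<or> z = x) \<Longrightarrow> U C" for U B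
  proof -
    let ?U = "{[ElemF B] | B. U B} :: ('k, 'f) kf_elem list set"
    obtain E where E: "\<not> mem x E" for x using ax'(2) by blast
    have "star_empty X Y mm = [ElemF E]"
      using char[of E "\<lambda>_. False"] E by (simp add: star_empty_def)
    then have "star_empty X Y mm \<in> ?U" using e[OF E] by simp
    moreover have "star_union X Y mm [ElemF B] (star_single X Y mm [ElemK x]) \<in> ?U" if "U B" for B x
    proof -
      obtain S where S: "\<And>z. mem z S \<longleftrightarrow> z = x" using ax'(3) by blast
      obtain C where C: "\<And>z. mem z C \<longleftrightarrow> mem z B \<or> mem z S" using ax'(4) by blast
      have "star_single X Y mm [ElemK x] = [ElemF S]"
        using char[of S "\<lambda>u. u = [ElemK x]"] S by (simp add: star_single_def)
      moreover have "star_union X Y mm [ElemF B] [ElemF S] = [ElemF C]"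
        using char[of C "\<lambda>u. mm u [ElemF B] \<or> mm u [ElemF S]"] C by (simp add: star_union_def mm)
      ultimately show ?thesis using i[OF \<open>U B\<close>, of C x] C S by simp
    qed
    then have "\<forall>B\<in>?U. \<forall>x\<in>X. star_union X Y mm B (star_single X Y mm x) \<in> ?U"
      by (auto simp: X_def)
    ultimately have U_eq: "?U = Y"
      using dfn_dpred_F[OF U] by (intro ax(5)) (auto simp: Y_def)
    have "[ElemF B] \<in> ?U" unfolding U_eq by (simp add: Y_def)
    then show ?thesis by simp
  qed
qed

lemma dfn_const: "dfn (\<lambda>\<rho> \<sigma> \<tau>. Q)"
proof -
  have "dfn (\<lambda>\<rho> \<sigma> \<tau>. (0 :: 'k) = (if Q then 0 else 1))" by (rule dfn_eq[OF trm_const trm_const])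
  then show ?thesis by (simp split: if_splits)
qed

lemma trm_rename:
  assumes "trm t" shows "trm (\<lambda>\<rho> \<sigma> \<tau>. t (\<lambda>i. \<rho> (a i)) (\<lambda>i. \<sigma> (b i)) (\<lambda>i. \<tau> (c i)))"
  unfolding trm_def by (rule dfn_trm[OF assms])

lemma set_trm_rename:
  assumes "set_trm s" shows "set_trm (\<lambda>\<rho> \<sigma> \<tau>. s (\<lambda>i. \<rho> (a i)) (\<lambda>i. \<sigma> (b i)) (\<lambda>i. \<tau> (c i)))"
  unfolding set_trm_def by (rule dfn_set_trm[OF assms])

definition pfinite :: "'k set \<Rightarrow> bool" where
  "pfinite X \<longleftrightarrow> (\<exists>F. \<forall>x. mem x F \<longleftrightarrow> x \<in> X)"

lemma pfinite_obtain:
  assumes "pfinite X" obtains F where "\<And>x. mem x F \<longleftrightarrow> x \<in> X"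
  using assms by (auto simp: pfinite_def)

lemma pfinite_at_most_one: "pfinite {x. x = a \<and> Q}"
  using F_single[of a] F_empty by (cases Q) (auto simp: pfinite_def)

text \<open>
  The principle of replacement, by induction over \<open>A\<close>.  With \<open>R x y\<close> of the form \<open>y = g x \<and> P x\<close> it
  yields separation and images as well.
\<close>

lemma pfinite_UN:
  assumes R: "dfn (\<lambda>\<rho> \<sigma> \<tau>. R (\<rho> 0) (\<rho> 1))" and fin: "\<And>x. mem x A \<Longrightarrow> pfinite {y. R x y}"
  shows "pfinite {y. \<exists>x. mem x A \<and> R x y}"
proof -
  \<comment> \<open>Membership in \<open>A\<close> is kept in the induction, since only there the sets to be united are known to be finite.\<close>
  have "\<exists>F. \<forall>y. mem y F \<longleftrightarrow> (\<exists>x. mem x A \<and> mem x A \<and> R x y)"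
  proof (rule F_induct[where U = "\<lambda>B. \<exists>F. \<forall>y. mem y F \<longleftrightarrow> (\<exists>x. mem x B \<and> mem x A \<and> R x y)"])
    show "dfn (\<lambda>\<rho> \<sigma> \<tau>. \<exists>F. \<forall>y. mem y F \<longleftrightarrow> (\<exists>x. mem x (\<sigma> 0) \<and> mem x A \<and> R x y))"
      by (intro dfn_intros dfn_rel2[OF R])
  next
    fix E assume "\<And>x. \<not> mem x E"
    then show "\<exists>F. \<forall>y. mem y F \<longleftrightarrow> (\<exists>x. mem x E \<and> mem x A \<and> R x y)" using F_empty by simp
  next
    fix B a C
    assume "\<exists>F. \<forall>y. mem y F \<longleftrightarrow> (\<exists>x. mem x B \<and> mem x A \<and> R x y)"
      and C: "\<And>z. mem z C \<longleftrightarrow> mem z B \<or> z = a"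
    then obtain F where F: "\<And>y. mem y F \<longleftrightarrow> (\<exists>x. mem x B \<and> mem x A \<and> R x y)" by blast
    show "\<exists>F. \<forall>y. mem y F \<longleftrightarrow> (\<exists>x. mem x C \<and> mem x A \<and> R x y)"
    proof (cases "mem a A")
      case True
      obtain G where "\<And>y. mem y G \<longleftrightarrow> R a y" using pfinite_obtain[OF fin[OF True]] by auto
      then show ?thesis using F_union[of F G] F C True by (metis (no_types, lifting))
    next
      case False
      then show ?thesis using F C by (metis (no_types, lifting))
    qed
  qed
  then show ?thesis by (simp add: pfinite_def)
qed

lemma dfn_rel3:
  assumes "dfn (\<lambda>\<rho> \<sigma> \<tau>. R (\<rho> 0) (\<rho> 1) (\<rho> 2))" "trm t" "trm u" "trm v"
  shows "dfn (\<lambda>\<rho> \<sigma> \<tau>. R (t \<rho> \<sigma> \<tau>) (u \<rho> \<sigma> \<tau>) (v \<rho> \<sigma> \<tau>))"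
proof -
  have "dfn (\<lambda>\<rho> \<sigma> \<tau>. R (\<rho> 2) (\<rho> 1) (\<rho> 0))"
    using dfn_rename[OF assms(1), of "\<lambda>i. 2 - i"] by simp
  then have "dfn (\<lambda>\<rho> \<sigma> \<tau>. \<exists>x y z. R x y z \<and> x = t \<rho> \<sigma> \<tau> \<and> y = u \<rho> \<sigma> \<tau> \<and> z = v \<rho> \<sigma> \<tau>)"
    by (intro dfn_exK dfn_conj dfn_trm assms) (simp add: numeral_2_eq_2)
  then show ?thesis by simp
qed

lemma pfinite_UN2:
  assumes R: "dfn (\<lambda>\<rho> \<sigma> \<tau>. R (\<rho> 0) (\<rho> 1) (\<rho> 2))"
    and fin: "\<And>x y. mem x A \<Longrightarrow> mem y B \<Longrightarrow> pfinite {z. R x y z}"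
  shows "pfinite {z. \<exists>x. mem x A \<and> (\<exists>y. mem y B \<and> R x y z)}"
  by (intro pfinite_UN fin dfn_intros dfn_rel3[OF R])

lemma pfinite_sep:
  assumes P: "dfn (\<lambda>\<rho> \<sigma> \<tau>. P (\<rho> 0))" shows "pfinite {x. mem x A \<and> P x}"
proof -
  have "pfinite {y. \<exists>x. mem x A \<and> (y = x \<and> P x)}"
    by (intro pfinite_UN pfinite_at_most_one dfn_intros dfn_rel1[OF P])
  then show ?thesis by (rule back_subst[where P = pfinite]) blast
qed

lemma minus_one_notin_NN: "- 1 \<notin> K0 mem"
  using char0 by (simp add: definable_char_zero_def)

text \<open>Such a set contains \<open>- 1\<close>, and it is itself the witness required for \<open>- 1 \<in> K0\<close>.\<close>

lemma pfinite_closed_pred: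
  assumes "pfinite G" "0 \<in> G" "\<And>z. z \<in> G \<Longrightarrow> z - 1 \<in> G" shows False
proof -
  obtain F where F: "\<And>x. mem x F \<longleftrightarrow> x \<in> G" using pfinite_obtain[OF assms(1)] by blast
  have "- 1 \<in> G" using assms(3)[OF assms(2)] by simp
  then have "- 1 \<in> K0 mem" unfolding K0_def using F assms(3) by (auto intro!: exI[of _ F])
  with minus_one_notin_NN show False ..
qed

lemma not_pfinite_UNIV: "pfinite X \<Longrightarrow> \<exists>x. x \<notin> X"
  using pfinite_closed_pred by blast

section \<open>Arithmetic and induction\<close>

lemma zero_NN: "0 \<in> K0 mem"
  using F_single[of 0] by (auto simp: K0_def)

lemma succ_NN:
  assumes "n \<in> K0 mem" shows "n + 1 \<in> K0 mem"
proof -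
  obtain F where F: "mem n F" "\<And>z. mem z F \<Longrightarrow> z \<noteq> 0 \<Longrightarrow> mem (z - 1) F"
    using assms by (auto simp: K0_def)
  obtain S where S: "\<And>x. mem x S \<longleftrightarrow> x = n + 1" using F_single by blast
  obtain D where D: "\<And>x. mem x D \<longleftrightarrow> mem x F \<or> mem x S" using F_union by blast
  show ?thesis unfolding K0_def using F D S by (auto intro!: exI[of _ D])
qed

lemma pred_NN: "n \<in> K0 mem \<Longrightarrow> n \<noteq> 0 \<Longrightarrow> n - 1 \<in> K0 mem"
  by (auto simp: K0_def)

text \<open>
  If \<open>S\<close> fails at \<open>n\<close>, consider the failures in a witness of \<open>n \<in> K0\<close>.  They do not include 0, so with
  each of them its predecessor lies in the witness and is a failure as well.  Translated by \<open>- n\<close>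
  they contradict \<open>pfinite_closed_pred\<close>.
\<close>

lemma NN_induct:
  assumes S: "dfn (\<lambda>\<rho> \<sigma> \<tau>. S (\<rho> 0))" and S0: "S 0"
    and step: "\<And>n. n \<in> K0 mem \<Longrightarrow> S n \<Longrightarrow> S (n + 1)" and n: "n \<in> K0 mem"
  shows "S n"
proof (rule ccontr)
  assume "\<not> S n"
  obtain F where F: "mem n F" "\<And>z. mem z F \<Longrightarrow> z \<noteq> 0 \<Longrightarrow> mem (z - 1) F"
    using n by (auto simp: K0_def)
  have FN: "z \<in> K0 mem" if "mem z F" for z using that F(2) by (auto simp: K0_def)
  define G where "G = {z. \<exists>x. mem x F \<and> (z = x - n \<and> \<not> S x)}"
  have "pfinite G" unfolding G_def
    by (intro pfinite_UN pfinite_at_most_one dfn_intros dfn_rel1[OF S])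
  moreover have "0 \<in> G" using F(1) \<open>\<not> S n\<close> by (auto simp: G_def)
  moreover have "z - 1 \<in> G" if z: "z \<in> G" for z
  proof -
    obtain x where x: "mem x F" "z = x - n" "\<not> S x" using z by (auto simp: G_def)
    then have "x \<noteq> 0" using S0 by auto
    then have "mem (x - 1) F" using F(2) x by blast
    moreover have "\<not> S (x - 1)" using step[OF FN[OF \<open>mem (x - 1) F\<close>]] x by auto
    ultimately show ?thesis unfolding G_def using x(2) by (auto intro!: exI[of _ "x - 1"])
  qed
  ultimately show False by (rule pfinite_closed_pred)
qed

lemma add_NN:
  assumes "m \<in> K0 mem" "n \<in> K0 mem" shows "m + n \<in> K0 mem"
proof (rule NN_induct[where S = "\<lambda>n. m + n \<in> K0 mem" and n = n])
  show "dfn (\<lambda>\<rho> \<sigma> \<tau>. m + \<rho> 0 \<in> K0 mem)" by (intro dfn_intros dfn_NN)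
qed (use assms succ_NN in \<open>auto simp flip: add.assoc\<close>)

lemma of_nat_times_NN: "m \<in> K0 mem \<Longrightarrow> of_nat l * m \<in> K0 mem"
  by (induction l) (auto simp: distrib_right zero_NN add_NN)

lemma of_nat_NN: "of_nat l \<in> K0 mem"
  by (induction l) (auto simp: zero_NN succ_NN add.commute[of 1])

lemma succ_NN_nonzero: "n \<in> K0 mem \<Longrightarrow> n + 1 \<noteq> 0"
  using minus_one_notin_NN by (auto simp: add_eq_0_iff2)

lemma NN_linear:
  assumes "m \<in> K0 mem" "n \<in> K0 mem" shows "m - n \<in> K0 mem \<or> n - m \<in> K0 mem"
proof (rule NN_induct[where S = "\<lambda>m. m - n \<in> K0 mem \<or> n - m \<in> K0 mem" and n = m])
  show "dfn (\<lambda>\<rho> \<sigma> \<tau>. \<rho> 0 - n \<in> K0 mem \<or> n - \<rho> 0 \<in> K0 mem)"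
    by (intro dfn_intros dfn_NN)
next
  fix m assume IH: "m - n \<in> K0 mem \<or> n - m \<in> K0 mem"
  show "m + 1 - n \<in> K0 mem \<or> n - (m + 1) \<in> K0 mem"
  proof (cases "m - n \<in> K0 mem")
    case True
    then show ?thesis using succ_NN[OF True] by (simp add: algebra_simps)
  next
    case False
    then have "n - m \<in> K0 mem" "n - m \<noteq> 0" using IH zero_NN by auto
    then show ?thesis using pred_NN[of "n - m"] by (simp add: algebra_simps)
  qed
qed (use assms in auto)

text \<open>
  Division with remainder by a standard number is unique.  If \<open>m - n\<close> were a successor \<open>d + 1\<close>, then
  \<open>l * d + r + 1 = 0\<close> for the standard number \<open>r\<close> with \<open>l + i = j + r + 1\<close>.
\<close>

lemma of_nat_times_add_inj:
  assumes "m \<in> K0 mem" "n \<in> K0 mem" "i < l" "j < l"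
    and eq: "of_nat l * m + of_nat i = of_nat l * n + of_nat j"
  shows "m = n \<and> i = j"
proof -
  have aux: "m = n" if mn: "m - n \<in> K0 mem" and ij: "i < l" "j < l"
    and e: "of_nat l * m + of_nat i = of_nat l * n + of_nat j" for m n i j
  proof (rule ccontr)
    assume "m \<noteq> n"
    define d where "d = m - n - 1"
    have d: "d \<in> K0 mem" using pred_NN[OF mn] \<open>m \<noteq> n\<close> by (simp add: d_def)
    obtain r where r: "l + i = Suc (j + r)" using ij less_iff_Suc_add[of j "l + i"] by auto
    have "of_nat l * d + of_nat r + 1 = of_nat l * d + of_nat (Suc (j + r)) - of_nat j"
      by simp
    also have "\<dots> = of_nat l * (d + 1) + of_nat i - of_nat j"
      by (simp add: algebra_simps flip: r)
    also have "\<dots> = 0" using e by (simp add: d_def algebra_simps)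
    finally show False
      using succ_NN_nonzero[OF add_NN[OF of_nat_times_NN[OF d] of_nat_NN]] by simp
  qed
  have mn: "m = n" using NN_linear[OF assms(1,2)] aux[of m n i j] aux[of n m j i] assms by auto
  have inj: "i \<ge> j" if e: "of_nat i = (of_nat j :: 'k)" for i j
  proof (rule ccontr)
    assume "\<not> i \<ge> j"
    then obtain r where "j = Suc (i + r)" using less_iff_Suc_add[of i j] by auto
    then have "of_nat r + 1 = (0 :: 'k)" using e by (simp add: algebra_simps)
    with succ_NN_nonzero[OF of_nat_NN] show False by blast
  qed
  show ?thesis using mn eq inj[of i j] inj[of j i] by simp
qed

section \<open>Coding sequences of finite sets\<close>

text \<open>
  The fiber over \<open>j\<close> of the relation on \<open>A \<times> B\<close> coded by the set \<open>C\<close> of values \<open>j + t * x\<close>.  The relation is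
  the intended one if \<open>(j, x) \<mapsto> j + t * x\<close> is injective on \<open>A \<times> B\<close>.
\<close>

definition fiber :: "'f \<Rightarrow> 'f \<Rightarrow> 'f \<Rightarrow> 'k \<Rightarrow> 'k \<Rightarrow> 'k \<Rightarrow> bool" where
  "fiber A B C t j x \<longleftrightarrow> mem j A \<and> mem x B \<and> mem (j + t * x) C"

text \<open>
  A slope is bad only if it is of the form \<open>- d / e\<close> for differences \<open>d\<close>, \<open>e \<noteq> 0\<close> of elements of \<open>A\<close> and
  of \<open>B\<close>.  These form a pseudofinite set, which is not all of \<open>K\<close>.
\<close>

lemma separating_slope:
  "\<exists>t. \<forall>a a' b b'. mem a A \<longrightarrow> mem a' A \<longrightarrow> mem b B \<longrightarrow> mem b' B \<longrightarrow>
     a + t * b = a' + t * b' \<longrightarrow> a = a' \<and> b = b'"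
proof -
  have "pfinite {d. \<exists>x. mem x X \<and> (\<exists>y. mem y X \<and> d = x - y \<and> True)}" for X
    by (intro pfinite_UN2 pfinite_at_most_one dfn_intros dfn_const)
  then obtain D where D: "\<And>X d. mem d (D X) \<longleftrightarrow> (\<exists>x. mem x X \<and> (\<exists>y. mem y X \<and> d = x - y))"
    unfolding pfinite_def by simp metis
  have "pfinite {t. \<exists>d. mem d (D A) \<and> (\<exists>e. mem e (D B) \<and> (\<not> e = 0 \<and> d + t * e = 0))}"
  proof (intro pfinite_UN2 dfn_intros)
    fix d e :: 'k
    have "d + t * e = 0 \<longleftrightarrow> t = - d / e" if "e \<noteq> 0" for t
      unfolding nonzero_eq_divide_eq[OF that] by (simp add: add_eq_0_iff)
    then have "{t. e \<noteq> 0 \<and> d + t * e = 0} = {t. t = - d / e \<and> e \<noteq> 0}" by blast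
    then show "pfinite {t. \<not> e = 0 \<and> d + t * e = 0}" by (simp add: pfinite_at_most_one)
  qed
  from not_pfinite_UNIV[OF this] obtain t
    where t: "\<And>d e. mem d (D A) \<Longrightarrow> mem e (D B) \<Longrightarrow> d + t * e = 0 \<Longrightarrow> e = 0" by auto
  have "a = a' \<and> b = b'" if "mem a A" "mem a' A" "mem b B" "mem b' B" "a + t * b = a' + t * b'" for a a' b b'
  proof -
    have "(a - a') + t * (b - b') = 0" using that(5) by (simp add: algebra_simps)
    moreover have "mem (a - a') (D A)" "mem (b - b') (D B)" using that D by blast+
    ultimately have "b - b' = 0" using t by blast
    then show ?thesis using that(5) by simp
  qed
  then show ?thesis by blast
qed

lemma dfn_fiber:
  assumes "set_trm A" "set_trm B" "set_trm C" "trm t" "trm j" "trm x"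
  shows "dfn (\<lambda>\<rho> \<sigma> \<tau>. fiber (A \<rho> \<sigma> \<tau>) (B \<rho> \<sigma> \<tau>) (C \<rho> \<sigma> \<tau>) (t \<rho> \<sigma> \<tau>) (j \<rho> \<sigma> \<tau>) (x \<rho> \<sigma> \<tau>))"
  unfolding fiber_def by (intro dfn_intros assms)

text \<open>
  Enlarging the projections may make the old slope bad, so that a new one is chosen and the whole
  relation is coded afresh.
\<close>

lemma fiber_update:
  "\<exists>A' B' C' t'. \<forall>j x. fiber A' B' C' t' j x \<longleftrightarrow> (if j = k then mem x E else fiber A B C t j x)"
proof -
  obtain S where S: "\<And>x. mem x S \<longleftrightarrow> x = k" using F_single by blast
  obtain A' where A': "\<And>x. mem x A' \<longleftrightarrow> mem x A \<or> mem x S" using F_union by blast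
  obtain B' where B': "\<And>x. mem x B' \<longleftrightarrow> mem x B \<or> mem x E" using F_union by blast
  obtain t' where t': "\<And>a a' b b'. mem a A' \<Longrightarrow> mem a' A' \<Longrightarrow> mem b B' \<Longrightarrow> mem b' B' \<Longrightarrow>
     a + t' * b = a' + t' * b' \<Longrightarrow> a = a' \<and> b = b'" using separating_slope by blast
  let ?Q = "\<lambda>j x. if j = k then mem x E else fiber A B C t j x"
  have "pfinite {v. \<exists>a. mem a A' \<and> (\<exists>b. mem b B' \<and> (v = a + t' * b \<and> ?Q a b))}"
    by (intro pfinite_UN2 pfinite_at_most_one dfn_intros dfn_fiber)
  then obtain C' where C': "\<And>v. mem v C' \<longleftrightarrow> (\<exists>a. mem a A' \<and> (\<exists>b. mem b B' \<and> (v = a + t' * b \<and> ?Q a b)))"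
    by (auto simp: pfinite_def)
  have "fiber A' B' C' t' j x \<longleftrightarrow> ?Q j x" for j x
  proof
    assume "fiber A' B' C' t' j x"
    then show "?Q j x" unfolding fiber_def[of A'] C' using t' by blast
  next
    assume Q: "?Q j x"
    then have "mem j A'" "mem x B'" using A' B' S by (auto simp: fiber_def split: if_splits)
    with Q show "fiber A' B' C' t' j x" unfolding fiber_def[of A'] C' by blast
  qed
  then show ?thesis by blast
qed

lemma fiber_update_many:
  assumes "inj_on idx {..<n::nat}"
  shows "\<exists>A' B' C' t'. (\<forall>i<n. \<forall>x. fiber A' B' C' t' (idx i) x \<longleftrightarrow> mem x (b i)) \<and>
    (\<forall>j. j \<notin> idx ` {..<n} \<longrightarrow> (\<forall>x. fiber A' B' C' t' j x \<longleftrightarrow> fiber A B C t j x))"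
  using assms
proof (induction n)
  case 0
  then show ?case by auto
next
  case (Suc n)
  have "inj_on idx {..<n}" using Suc.prems by (rule inj_on_subset) auto
  then obtain A1 B1 C1 t1 where 1: "\<And>i x. i < n \<Longrightarrow> fiber A1 B1 C1 t1 (idx i) x \<longleftrightarrow> mem x (b i)"
    "\<And>j x. j \<notin> idx ` {..<n} \<Longrightarrow> fiber A1 B1 C1 t1 j x \<longleftrightarrow> fiber A B C t j x"
    using Suc.IH by blast
  obtain A2 B2 C2 t2 where 2: "\<And>j x. fiber A2 B2 C2 t2 j x \<longleftrightarrow>
      (if j = idx n then mem x (b n) else fiber A1 B1 C1 t1 j x)"
    using fiber_update[of "idx n" "b n" A1 B1 C1 t1] by blast
  have "idx i \<noteq> idx n" if "i < n" for i
    using inj_onD[OF Suc.prems, of i n] that by auto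
  then have "\<forall>i<Suc n. \<forall>x. fiber A2 B2 C2 t2 (idx i) x \<longleftrightarrow> mem x (b i)"
    using 1(1) 2 by (auto simp: less_Suc_eq)
  moreover have "\<forall>j. j \<notin> idx ` {..<Suc n} \<longrightarrow> (\<forall>x. fiber A2 B2 C2 t2 j x \<longleftrightarrow> fiber A B C t j x)"
    using 1(2) 2 by (auto simp: lessThan_Suc)
  ultimately show ?case by blast
qed

definition row :: "'f \<Rightarrow> 'f \<Rightarrow> 'f \<Rightarrow> 'k \<Rightarrow> 'k \<Rightarrow> 'f" where
  "row A B C t j = (THE F. \<forall>x. mem x F \<longleftrightarrow> fiber A B C t j x)"

lemma row_eqI: "(\<And>x. mem x F \<longleftrightarrow> fiber A B C t j x) \<Longrightarrow> row A B C t j = F"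
  unfolding row_def by (rule the_equality) (auto intro: F_ext)

lemma mem_row: "mem x (row A B C t j) \<longleftrightarrow> fiber A B C t j x"
proof -
  have "pfinite {x. mem x B \<and> fiber A B C t j x}"
    by (intro pfinite_sep dfn_fiber dfn_intros)
  then obtain F where "\<And>x. mem x F \<longleftrightarrow> fiber A B C t j x" by (auto simp: pfinite_def fiber_def)
  with row_eqI[of F] show ?thesis by simp
qed

lemma set_trm_row:
  assumes "set_trm A" "set_trm B" "set_trm C" "trm t" "trm j"
  shows "set_trm (\<lambda>\<rho> \<sigma> \<tau>. row (A \<rho> \<sigma> \<tau>) (B \<rho> \<sigma> \<tau>) (C \<rho> \<sigma> \<tau>) (t \<rho> \<sigma> \<tau>) (j \<rho> \<sigma> \<tau>))"
  unfolding set_trm_def mem_row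
  by (intro dfn_fiber trm_var assms(1-3)[THEN set_trm_rename] assms(4,5)[THEN trm_rename])

section \<open>Coding imaginaries by finite sets\<close>

text \<open>The field element stored as a singleton; the default value 0 for other sets keeps decoding total.\<close>

definition point :: "'f \<Rightarrow> 'k" where
  "point B = (if \<exists>a. \<forall>x. mem x B \<longleftrightarrow> x = a then THE a. \<forall>x. mem x B \<longleftrightarrow> x = a else 0)"

primrec elem :: "kf_sort \<Rightarrow> 'f \<Rightarrow> ('k, 'f) kf_elem" where
  "elem SortK B = ElemK (point B)"
| "elem SortF B = ElemF B"

definition elems :: "kf_sort list \<Rightarrow> (nat \<Rightarrow> 'f) \<Rightarrow> ('k, 'f) kf_elem list" where
  "elems ds b = map (\<lambda>q. elem (ds ! q) (b q)) [0..<length ds]"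

definition dim :: nat where
  "dim = length (allsorts ss)"

text \<open>
  Only \<open>b 0, ..., b (dim - 1)\<close> matter.  A function on all numbers is used to avoid lists of a fixed
  length.
\<close>

definition decode :: "(nat \<Rightarrow> 'f) \<Rightarrow> ('k, 'f) imag list" where
  "decode b = imags_of ss (elems (allsorts ss) b)"

lemma point_eq: "a = point B \<longleftrightarrow> (\<forall>x. mem x B \<longleftrightarrow> x = a) \<or> \<not> (\<exists>c. \<forall>x. mem x B \<longleftrightarrow> x = c) \<and> a = 0"
proof (cases "\<exists>c. \<forall>x. mem x B \<longleftrightarrow> x = c")
  case True
  then obtain c where c: "\<And>x. mem x B \<longleftrightarrow> x = c" by blast
  then have "point B = c" by (auto simp: point_def)
  with c show ?thesis by auto
next
  case False
  then show ?thesis by (auto simp: point_def)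
qed

lemma elem_surj: "\<exists>B. elem s B = z" if "z \<in> carr (kf_struct mem) s"
proof (cases s)
  case SortK
  with that obtain a where z: "z = ElemK a" by (auto simp: kf_struct_def)
  obtain B where "\<And>x. mem x B \<longleftrightarrow> x = a" using F_single by blast
  then have "a = point B" by (subst point_eq) blast
  with SortK z show ?thesis by (auto intro!: exI[of _ B])
next
  case SortF
  with that show ?thesis by (auto simp: kf_struct_def)
qed

lemma elem_carr: "elem s B \<in> carr (kf_struct mem) s"
  by (cases s) (auto simp: kf_struct_def)

lemma elems_tuple: "elems ds b \<in> tuples (kf_struct mem) ds"
  by (simp add: tuples_iff elems_def elem_carr)

lemma decode_tuple: "decode b \<in> T"
  unfolding decode_def imags_of_image using elems_tuple by blast

lemma decode_surj:
  assumes "y \<in> T" shows "\<exists>b. decode b = y"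
proof -
  obtain zs where zs: "zs \<in> tuples (kf_struct mem) (allsorts ss)" "y = imags_of ss zs"
    using assms by (auto simp: imags_of_image)
  have "\<exists>B. elem (allsorts ss ! q) B = zs ! q" if "q < length (allsorts ss)" for q
    using elem_surj tuples_nth[OF zs(1) that] by blast
  then obtain b where "\<And>q. q < length (allsorts ss) \<Longrightarrow> elem (allsorts ss ! q) (b q) = zs ! q"
    by metis
  then have "elems (allsorts ss) b = zs"
    using tuples_length[OF zs(1)] by (intro nth_equalityI) (simp_all add: elems_def)
  then show ?thesis using zs(2) by (auto simp: decode_def)
qed

lemma decode_cong: "(\<And>i. i < dim \<Longrightarrow> b i = c i) \<Longrightarrow> decode b = decode c"
  unfolding decode_def elems_def dim_def by (rule arg_cong[where f = "imags_of ss"]) simp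

lemma dpred_elem:
  assumes pl: "places \<Gamma> f g p" and m: "m < length \<Gamma>" "\<Gamma> ! m = HomeSort d"
  shows "dpred Meq \<Gamma> (\<lambda>xs. xs ! m = HomeElem (elem d (unF (xs ! g j))))"
proof (cases d)
  case SortF
  have "dpred Meq \<Gamma> (\<lambda>xs. xs ! m = xs ! g j)"
    using pl m SortF by (intro dpred_eq) (auto simp: places_def)
  then show ?thesis
    by (rule dpred_cong) (simp add: SortF nth_inF[OF pl])
next
  case SortK
  have "dfn (\<lambda>\<rho> \<sigma> \<tau>. \<rho> 0 = point (\<sigma> 0))"
    unfolding point_eq by (intro dfn_intros)
  moreover have pl': "places \<Gamma> (\<lambda>_. m) (\<lambda>_. g j) p"
    using pl m SortK by (auto simp: places_def)
  ultimately have "dpred Meq \<Gamma> (\<lambda>xs. unK (xs ! m) = point (unF (xs ! g j)))"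
    by (rule dfnD)
  then show ?thesis
  proof (rule dpred_cong)
    fix xs assume "xs \<in> tuples Meq \<Gamma>"
    from nth_inK[OF pl' this, symmetric] obtain x where "xs ! m = inK x" by blast
    then show "unK (xs ! m) = point (unF (xs ! g j)) \<longleftrightarrow> xs ! m = HomeElem (elem d (unF (xs ! g j)))"
      by (simp add: SortK)
  qed
qed

text \<open>
  For a quotient sort, the representative is named by a block of quantified variables and
  related to the class by the projection symbol.
\<close>

lemma dpred_imag_of:
  assumes pl: "places \<Gamma> f g p" and m: "m < length \<Gamma>"
  shows "dpred Meq \<Gamma> (\<lambda>xs. xs ! m = imag_of (\<Gamma> ! m) (elems (rep_sorts (\<Gamma> ! m)) (\<lambda>q. unF (xs ! g (js q)))))"
proof (cases "\<Gamma> ! m")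
  case (HomeSort d)
  from dpred_elem[OF pl m this, of "js 0"] show ?thesis
    by (rule dpred_cong) (simp add: HomeSort elems_def)
next
  case (QuotSort ds E)
  let ?H = "map HomeSort ds :: ('k, 'f) imag_sort list" and ?n = "length ds"
  have H: "set ?H \<subseteq> sorts Meq" using home_sorts by auto
  have \<Gamma>: "set \<Gamma> \<subseteq> sorts Meq" using pl by (simp add: places_def)
  have pl': "places (?H @ \<Gamma>) (\<lambda>i. ?n + f i) (\<lambda>i. ?n + g i) (\<lambda>i. ?n + p i)"
    using pl H by (auto simp: places_def nth_append add.assoc)
  let ?P = "\<lambda>xs. (\<forall>q<?n. xs ! q = HomeElem (elem (ds ! q) (unF (xs ! (?n + g (js q)))))) \<and>
    interp Meq (ProjSym ds E) (map (\<lambda>i. xs ! i) ([0..<?n] @ [?n + m]))"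
  have "dpred Meq (?H @ \<Gamma>) ?P"
  proof (intro dpred_conj dpred_all_less)
    show "dpred Meq (?H @ \<Gamma>) (\<lambda>xs. interp Meq (ProjSym ds E) (map (\<lambda>i. xs ! i) ([0..<?n] @ [?n + m])))"
    proof (rule dpred_rel)
      show "map (\<lambda>i. (?H @ \<Gamma>) ! i) ([0..<?n] @ [?n + m]) = arity Meq (ProjSym ds E)"
      proof -
        have "map (\<lambda>i. (?H @ \<Gamma>) ! i) [0..<?n] = ?H"
          by (intro nth_equalityI) (simp_all add: nth_append)
        then show ?thesis using QuotSort by (simp add: eq_struct_def nth_append)
      qed
    qed (use H \<Gamma> m in auto)
    show "HomeSort SortK \<in> sorts Meq" by (rule home_sorts)
    show "set (?H @ \<Gamma>) \<subseteq> sorts Meq" using H \<Gamma> by simp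
  next
    fix q assume "q < ?n"
    then show "dpred Meq (?H @ \<Gamma>) (\<lambda>xs. xs ! q = HomeElem (elem (ds ! q) (unF (xs ! (?n + g (js q))))))"
      by (intro dpred_elem[OF pl']) (simp_all add: nth_append)
  qed
  from dpred_exs[OF this] show ?thesis
  proof (rule dpred_cong)
    fix xs :: "('k, 'f) imag list"
    let ?b = "\<lambda>q. unF (xs ! g (js q))"
    have H_tuple: "map HomeElem (elems ds ?b) \<in> tuples Meq ?H"
      using elem_carr by (auto simp: tuples_iff elems_def eq_struct_def)
    have iff: "?P (zs @ xs) \<longleftrightarrow> zs = map HomeElem (elems ds ?b) \<and> xs ! m = ClassElem ds E (E `` {elems ds ?b})"
      if zs: "zs \<in> tuples Meq ?H" for zs
    proof -
      have l: "length zs = ?n" using tuples_length[OF zs] by simp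
      have "(\<forall>q<?n. (zs @ xs) ! q = HomeElem (elem (ds ! q) (unF ((zs @ xs) ! (?n + g (js q))))))
          \<longleftrightarrow> zs = map HomeElem (elems ds ?b)"
        unfolding list_eq_iff_nth_eq[of zs] by (simp add: l nth_append elems_def)
      moreover have "map (\<lambda>i. (zs @ xs) ! i) [0..<?n] = zs"
        by (intro nth_equalityI) (simp_all add: l nth_append)
      then have "map (\<lambda>i. (zs @ xs) ! i) ([0..<?n] @ [?n + m]) = zs @ [xs ! m]"
        by (simp add: l nth_append)
      moreover have "interp Meq (ProjSym ds E) (map HomeElem (elems ds ?b) @ [xs ! m]) \<longleftrightarrow>
          xs ! m = ClassElem ds E (E `` {elems ds ?b})"
        using elems_tuple by (auto simp: eq_struct_def map_HomeElem_eq)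
      ultimately show ?thesis by (metis (no_types, lifting))
    qed
    have "(\<exists>zs\<in>tuples Meq ?H. ?P (zs @ xs)) \<longleftrightarrow> (\<exists>zs\<in>tuples Meq ?H.
        zs = map HomeElem (elems ds ?b) \<and> xs ! m = ClassElem ds E (E `` {elems ds ?b}))"
      by (rule bex_cong[OF refl iff])
    then show "(\<exists>zs\<in>tuples Meq ?H. ?P (zs @ xs)) \<longleftrightarrow>
        xs ! m = imag_of (\<Gamma> ! m) (elems (rep_sorts (\<Gamma> ! m)) ?b)"
      using H_tuple by (simp add: QuotSort)
  qed
qed

lemma dfn_decode_vars: "dfn (\<lambda>\<rho> \<sigma> \<tau>. decode \<sigma> = \<tau> l)"
  unfolding dfn_def
proof (intro allI impI)
  fix \<Gamma> f g p assume pl: "places \<Gamma> f g p"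
  have \<Gamma>: "set \<Gamma> \<subseteq> sorts Meq" using pl by (simp add: places_def)
  have "dpred Meq \<Gamma> (\<lambda>xs. xs ! (p l + k) =
      imag_of (ss ! k) (elems (rep_sorts (ss ! k)) (\<lambda>q. unF (xs ! g (offset ss k + q)))))"
    if k: "k < length ss" for k
  proof -
    have "\<Gamma> ! (p l + k) = ss ! k" using pl k by (simp add: places_def)
    with dpred_imag_of[OF pl places_less[OF pl k], of l "\<lambda>q. offset ss k + q"] show ?thesis by simp
  qed
  then have "dpred Meq \<Gamma> (\<lambda>xs. \<forall>k<length ss. xs ! (p l + k) =
      imag_of (ss ! k) (elems (rep_sorts (ss ! k)) (\<lambda>q. unF (xs ! g (offset ss k + q)))))"
    by (intro dpred_all_less[OF \<Gamma> home_sorts])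
  then show "dpred Meq \<Gamma> (\<lambda>xs. decode (\<lambda>i. unF (xs ! g i)) = block (p l) xs)"
  proof (rule dpred_cong)
    fix xs :: "('k, 'f) imag list"
    let ?b = "\<lambda>i. unF (xs ! g i)"
    have nth: "decode ?b ! k = imag_of (ss ! k) (elems (rep_sorts (ss ! k)) (\<lambda>q. ?b (offset ss k + q)))"
      if k: "k < length ss" for k
    proof -
      let ?zs = "elems (allsorts ss) ?b"
      have "map (\<lambda>j. ?zs ! j) (blockpos ss k) = elems (rep_sorts (ss ! k)) (\<lambda>q. ?b (offset ss k + q))"
      proof (rule nth_equalityI)
        fix q assume "q < length (map (\<lambda>j. ?zs ! j) (blockpos ss k))"
        then have q: "q < length (rep_sorts (ss ! k))" by simp
        have "allsorts ss ! (offset ss k + q) = rep_sorts (ss ! k) ! q"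
          using arg_cong[OF nth_blockpos[OF k], of "\<lambda>zs. zs ! q"] q by simp
        then show "map (\<lambda>j. ?zs ! j) (blockpos ss k) ! q
            = elems (rep_sorts (ss ! k)) (\<lambda>q. ?b (offset ss k + q)) ! q"
          using q blockpos_bound[OF k] by (simp add: elems_def)
      qed (simp add: elems_def)
      moreover have "length ?zs = length (allsorts ss)" by (simp add: elems_def)
      ultimately show ?thesis unfolding decode_def using nth_imags_of[OF k, of ?zs] by simp
    qed
    show "(\<forall>k<length ss. xs ! (p l + k) =
      imag_of (ss ! k) (elems (rep_sorts (ss ! k)) (\<lambda>q. ?b (offset ss k + q)))) \<longleftrightarrow> decode ?b = block (p l) xs"
      unfolding list_eq_iff_nth_eq[of "decode ?b"]
      using nth by (auto simp: block_def decode_def)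
  qed
qed

text \<open>By extensionality, the value of a set term can be named by a quantified variable.\<close>

lemma dfn_letF:
  assumes "set_trm s" "dfn (\<lambda>\<rho> \<sigma> \<tau>. P (\<sigma> 0) \<rho> (\<lambda>i. \<sigma> (Suc i)) \<tau>)"
  shows "dfn (\<lambda>\<rho> \<sigma> \<tau>. P (s \<rho> \<sigma> \<tau>) \<rho> \<sigma> \<tau>)"
proof -
  have "dfn (\<lambda>\<rho> \<sigma> \<tau>. \<exists>B. (\<forall>x. mem x B \<longleftrightarrow> mem x (s \<rho> \<sigma> \<tau>)) \<and> P B \<rho> \<sigma> \<tau>)"
    by (intro dfn_exF dfn_conj dfn_allK dfn_iff assms(2) dfn_mem_var dfn_set_trm assms(1))
  moreover have "(\<forall>x. mem x B \<longleftrightarrow> mem x C) \<longleftrightarrow> B = C" for B C using F_ext by auto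
  ultimately show ?thesis by simp
qed

text \<open>
  The set terms are substituted one after the other for the variables in \<open>dfn_decode_vars\<close>.  In
  between, even indices carry the variables of the terms, and odd indices the coordinates that are
  still to be substituted.
\<close>

lemma dfn_decode:
  assumes s: "\<And>i. set_trm (s i)"
  shows "dfn (\<lambda>\<rho> \<sigma> \<tau>. decode (\<lambda>i. s i \<rho> \<sigma> \<tau>) = \<tau> l)"
proof -
  have *: "dfn (\<lambda>\<rho> \<sigma> \<tau>. decode (\<lambda>i. if i < n then s i \<rho> (\<lambda>j. \<sigma> (2 * j)) \<tau> else \<sigma> (2 * i + 1)) = \<tau> l)" for n
  proof (induction n)
    case 0
    show ?case using dfn_rename[OF dfn_decode_vars, of "\<lambda>i. 2 * i + 1" "\<lambda>i. i" l] by simp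
  next
    case (Suc n)
    let ?b = "\<lambda>m. if m = 2 * n + 1 then 0 else Suc m"
    have "dfn (\<lambda>\<rho> \<sigma> \<tau>. decode (\<lambda>i. if i < n then s i \<rho> (\<lambda>j. \<sigma> (?b (2 * j))) \<tau> else \<sigma> (?b (2 * i + 1))) = \<tau> l)"
      by (rule dfn_rename[OF Suc, of "\<lambda>i. i" _ "\<lambda>i. i"])
    moreover have even: "?b (2 * j) = Suc (2 * j)" for j by presburger
    have "(if i < n then s i \<rho> (\<lambda>j. \<sigma> (?b (2 * j))) \<tau> else \<sigma> (?b (2 * i + 1))) =
        (if i < n then s i \<rho> (\<lambda>j. \<sigma> (Suc (2 * j))) \<tau>
         else if i = n then \<sigma> 0 else \<sigma> (Suc (2 * i + 1)))" for i \<rho> \<sigma> \<tau>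
      unfolding even by simp
    ultimately have "dfn (\<lambda>\<rho> \<sigma> \<tau>. decode (\<lambda>i. if i < n then s i \<rho> (\<lambda>j. \<sigma> (Suc (2 * j))) \<tau>
        else if i = n then \<sigma> 0 else \<sigma> (Suc (2 * i + 1))) = \<tau> l)"
      by (simp only:)
    from dfn_letF[where P = "\<lambda>B \<rho> \<sigma> \<tau>. decode (\<lambda>i. if i < n then s i \<rho> (\<lambda>j. \<sigma> (2 * j)) \<tau>
        else if i = n then B else \<sigma> (2 * i + 1)) = \<tau> l", OF set_trm_rename[OF s, of n "\<lambda>i. i" "\<lambda>j. 2 * j" "\<lambda>i. i"] this]
    have "dfn (\<lambda>\<rho> \<sigma> \<tau>. decode (\<lambda>i. if i < n then s i \<rho> (\<lambda>j. \<sigma> (2 * j)) \<tau>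
        else if i = n then s n \<rho> (\<lambda>j. \<sigma> (2 * j)) \<tau> else \<sigma> (2 * i + 1)) = \<tau> l)" .
    moreover have "(if i < n then s i \<rho> (\<lambda>j. \<sigma> (2 * j)) \<tau>
        else if i = n then s n \<rho> (\<lambda>j. \<sigma> (2 * j)) \<tau> else \<sigma> (2 * i + 1)) =
        (if i < Suc n then s i \<rho> (\<lambda>j. \<sigma> (2 * j)) \<tau> else \<sigma> (2 * i + 1))" for i \<rho> \<sigma> \<tau>
      by (simp add: less_Suc_eq)
    ultimately show ?case by simp
  qed
  have "dfn (\<lambda>\<rho> \<sigma> \<tau>. decode (\<lambda>i. if i < dim then s i \<rho> \<sigma> \<tau> else \<sigma> i) = \<tau> l)"
  proof -
    have div: "2 * j div 2 = j" "(2 * j + 1) div 2 = j" for j :: nat by simp_all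
    show ?thesis
      using dfn_rename[OF *[of dim], of "\<lambda>i. i" "\<lambda>m. m div 2" "\<lambda>i. i"] unfolding div .
  qed
  then show ?thesis
  proof (rule dfn_cong)
    fix \<rho> \<sigma> \<tau>
    have "decode (\<lambda>i. if i < dim then s i \<rho> \<sigma> \<tau> else \<sigma> i) = decode (\<lambda>i. s i \<rho> \<sigma> \<tau>)"
      by (rule decode_cong) simp
    then show "decode (\<lambda>i. if i < dim then s i \<rho> \<sigma> \<tau> else \<sigma> i) = \<tau> l \<longleftrightarrow>
      decode (\<lambda>i. s i \<rho> \<sigma> \<tau>) = \<tau> l" by simp
  qed
qed

section \<open>Definable relations on tuples\<close>

lemma dfn_definable2:
  assumes "definable Meq (fieldK # ss) A"
  shows "dfn (\<lambda>\<rho> \<sigma> \<tau>. inK (\<rho> i) # \<tau> j \<in> A)"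
proof -
  have "dpred Meq (fieldK # ss @ ss) (\<lambda>xs. map (\<lambda>k. xs ! k) [0..<Suc (length ss)] \<in> A)"
    using ss_sorts home_sorts
    by (intro dpred_subst[OF definable_dpred[OF assms]])
       (auto simp: nth_append nth_Cons' simp del: upt_Suc intro!: nth_equalityI)
  from dfn_definable3[OF this, of i j j] show ?thesis
  proof (rule dfn_cong)
    fix \<rho> :: "nat \<Rightarrow> 'k" and \<tau> :: "nat \<Rightarrow> ('k, 'f) imag list" assume "\<And>i. \<tau> i \<in> T"
    then have "length (\<tau> j) = length ss" by (metis tuples_length)
    then have "map (\<lambda>k. (inK (\<rho> i) # \<tau> j @ \<tau> j) ! k) [0..<Suc (length ss)] = inK (\<rho> i) # \<tau> j"
      by (intro nth_equalityI)
         (auto simp: nth_append nth_Cons' simp del: upt_Suc)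
    then show "map (\<lambda>k. (inK (\<rho> i) # \<tau> j @ \<tau> j) ! k) [0..<Suc (length ss)] \<in> A \<longleftrightarrow> inK (\<rho> i) # \<tau> j \<in> A"
      by simp
  qed
qed

lemma dfn_definable1:
  assumes "definable Meq ss A" shows "dfn (\<lambda>\<rho> \<sigma> \<tau>. \<tau> j \<in> A)"
proof -
  have "dpred Meq (fieldK # ss @ ss) (\<lambda>xs. map (\<lambda>k. xs ! Suc k) [0..<length ss] \<in> A)"
  proof -
    have "map (\<lambda>k. (fieldK # ss @ ss) ! k) (map Suc [0..<length ss]) = ss"
      by (intro nth_equalityI) (simp_all add: nth_append del: map_Suc_upt)
    then have "dpred Meq (fieldK # ss @ ss) (\<lambda>xs. map (\<lambda>k. xs ! k) (map Suc [0..<length ss]) \<in> A)"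
      using ss_sorts home_sorts by (intro dpred_subst[OF definable_dpred[OF assms]]) auto
    then show ?thesis by (simp add: o_def del: map_Suc_upt)
  qed
  from dfn_definable3[OF this, of 0 j j] show ?thesis
  proof (rule dfn_cong)
    fix \<rho> :: "nat \<Rightarrow> 'k" and \<tau> :: "nat \<Rightarrow> ('k, 'f) imag list" assume "\<And>i. \<tau> i \<in> T"
    then have "length (\<tau> j) = length ss" by (metis tuples_length)
    then have "map (\<lambda>k. (inK (\<rho> 0) # \<tau> j @ \<tau> j) ! Suc k) [0..<length ss] = \<tau> j"
      by (intro nth_equalityI) (auto simp: nth_append)
    then show "map (\<lambda>k. (inK (\<rho> 0) # \<tau> j @ \<tau> j) ! Suc k) [0..<length ss] \<in> A \<longleftrightarrow> \<tau> j \<in> A"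
      by simp
  qed
qed

lemma dfn_tuple_eq: "dfn (\<lambda>\<rho> \<sigma> \<tau>. \<tau> i = \<tau> j)"
  unfolding dfn_def
proof (intro allI impI)
  fix \<Gamma> f g p assume pl: "places \<Gamma> f g p"
  have "dpred Meq \<Gamma> (\<lambda>xs. \<forall>k<length ss. xs ! (p i + k) = xs ! (p j + k))"
    using pl by (intro dpred_all_less[OF _ home_sorts] dpred_eq) (auto simp: places_def places_less[OF pl])
  then show "dpred Meq \<Gamma> (\<lambda>xs. block (p i) xs = block (p j) xs)"
    by (rule dpred_cong) (auto simp: block_def)
qed

lemma definable_graph:
  assumes "dfn (\<lambda>\<rho> \<sigma> \<tau>. G (\<rho> 0) (\<tau> 0))"
  shows "definable Meq (fieldK # ss) {inK n # y | n y. y \<in> T \<and> G n y}"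
proof -
  let ?\<Gamma> = "(fieldK # ss) @ [fieldF]"
  have pl: "places ?\<Gamma> (\<lambda>_. 0) (\<lambda>_. Suc (length ss)) (\<lambda>_. 1)"
    using ss_sorts by (auto simp: places_def home_sorts nth_append)
  obtain B :: 'f where True by simp
  from dpred_param[OF dfnD[OF assms pl], of "[inF B]"]
  have "dpred Meq (fieldK # ss) (\<lambda>xs. G (unK ((xs @ [inF B]) ! 0)) (block 1 (xs @ [inF B])))"
    by (simp add: carr_fieldF)
  from dpred_definable[OF this]
  have "definable Meq (fieldK # ss)
    {xs \<in> tuples Meq (fieldK # ss). G (unK ((xs @ [inF B]) ! 0)) (block 1 (xs @ [inF B]))}" .
  also have "{xs \<in> tuples Meq (fieldK # ss). G (unK ((xs @ [inF B]) ! 0)) (block 1 (xs @ [inF B]))}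
      = {inK n # y | n y. y \<in> T \<and> G n y}"
  proof -
    have "unK (((inK n # y) @ [inF B]) ! 0) = n" "block 1 ((inK n # y) @ [inF B]) = y" if "y \<in> T" for n y
      using block_Cons[of 0] block_0[OF tuples_length[OF that]] by simp_all
    then show ?thesis by (auto simp: tuples_Cons carr_fieldK simp del: append_Cons)
  qed
  finally show ?thesis .
qed

section \<open>Recursion\<close>

text \<open>Entry \<open>k\<close> of a coded sequence; its \<open>dim\<close> coordinates are consecutive rows.\<close>

definition seq_val :: "'f \<Rightarrow> 'f \<Rightarrow> 'f \<Rightarrow> 'k \<Rightarrow> 'k \<Rightarrow> ('k, 'f) imag list" where
  "seq_val A B C t k = decode (\<lambda>i. row A B C t (of_nat dim * k + of_nat i))"

lemma seq_val_tuple: "seq_val A B C t k \<in> T"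
  by (simp add: seq_val_def decode_tuple)

lemma dfn_seq_val:
  assumes "set_trm A" "set_trm B" "set_trm C" "trm t" "trm k"
  shows "dfn (\<lambda>\<rho> \<sigma> \<tau>. seq_val (A \<rho> \<sigma> \<tau>) (B \<rho> \<sigma> \<tau>) (C \<rho> \<sigma> \<tau>) (t \<rho> \<sigma> \<tau>) (k \<rho> \<sigma> \<tau>) = \<tau> l)"
  unfolding seq_val_def by (intro dfn_decode set_trm_row trm_plus trm_times trm_const assms)

text \<open>
  Entries at different places in \<open>N\<close> use different rows by \<open>of_nat_times_add_inj\<close>, so that an entry can
  be changed independently of the others.
\<close>

lemma seq_val_extend:
  assumes "m \<in> K0 mem" "y \<in> T"
  shows "\<exists>A' B' C' t'. seq_val A' B' C' t' m = y \<and>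
    (\<forall>k\<in>K0 mem. k \<noteq> m \<longrightarrow> seq_val A' B' C' t' k = seq_val A B C t k)"
proof -
  let ?idx = "\<lambda>k i. of_nat dim * k + of_nat i"
  obtain b where b: "decode b = y" using decode_surj[OF assms(2)] by blast
  have "inj_on (?idx m) {..<dim}"
    using of_nat_times_add_inj[OF assms(1,1)] by (auto simp: inj_on_def)
  then obtain A' B' C' t' where
    new: "\<forall>i<dim. \<forall>x. fiber A' B' C' t' (?idx m i) x \<longleftrightarrow> mem x (b i)" and
    old: "\<forall>j. j \<notin> ?idx m ` {..<dim} \<longrightarrow> (\<forall>x. fiber A' B' C' t' j x \<longleftrightarrow> fiber A B C t j x)"
    using fiber_update_many[of "?idx m" dim b A B C t] by blast
  have "seq_val A' B' C' t' m = decode b"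
    unfolding seq_val_def using new by (intro decode_cong row_eqI) simp
  moreover have "seq_val A' B' C' t' k = seq_val A B C t k" if k: "k \<in> K0 mem" "k \<noteq> m" for k
    unfolding seq_val_def
  proof (intro decode_cong row_eqI)
    fix i x assume i: "i < dim"
    have "?idx k i \<notin> ?idx m ` {..<dim}"
      using of_nat_times_add_inj[OF k(1) assms(1) i] k(2) by auto
    then show "mem x (row A B C t (?idx k i)) \<longleftrightarrow> fiber A' B' C' t' (?idx k i) x"
      using old by (simp add: mem_row)
  qed
  ultimately show ?thesis using b by blast
qed

text \<open>
  A code of the first values of the function: the steps at all \<open>k < n\<close>, expressed by
  \<open>n - 1 - k \<in> N\<close>, belong to the graph \<open>H\<close> of the recursion.  At \<open>n = 0\<close> no
  step is required, as \<open>- 1 - k\<close> and \<open>k\<close> cannot both be in \<open>N\<close>.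
\<close>

definition computation ::
  "('k, 'f) imag list set \<Rightarrow> 'k \<Rightarrow> 'f \<Rightarrow> 'f \<Rightarrow> 'f \<Rightarrow> 'k \<Rightarrow> bool" where
  "computation H n A B C t \<longleftrightarrow> seq_val A B C t 0 = y0 \<and>
     (\<forall>k. k \<in> K0 mem \<longrightarrow> n - 1 - k \<in> K0 mem \<longrightarrow>
        inK k # seq_val A B C t k @ seq_val A B C t (k + 1) \<in> H)"

definition reached :: "('k, 'f) imag list set \<Rightarrow> 'k \<Rightarrow> ('k, 'f) imag list \<Rightarrow> bool" where
  "reached H n y \<longleftrightarrow> (\<exists>A B C t. computation H n A B C t \<and> seq_val A B C t n = y)"

lemma definable_singleton: "definable Meq ss {y0}"
proof -
  have "dpred Meq (ss @ ss) (\<lambda>xs. \<forall>k<length ss. xs ! k = xs ! (length ss + k))"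
    using ss_sorts by (intro dpred_all_less[OF _ home_sorts] dpred_eq) (auto simp: nth_append)
  from dpred_definable[OF dpred_param[OF this y0_tuple]]
  have "definable Meq ss {y \<in> T. \<forall>k<length ss. (y @ y0) ! k = (y @ y0) ! (length ss + k)}" .
  also have "{y \<in> T. \<forall>k<length ss. (y @ y0) ! k = (y @ y0) ! (length ss + k)} = {y0}"
    using y0_tuple by (auto simp: tuples_length nth_append intro: nth_equalityI)
  finally show ?thesis .
qed

lemma dfn_reached:
  assumes H: "definable Meq (fieldK # ss @ ss) H"
  shows "dfn (\<lambda>\<rho> \<sigma> \<tau>. reached H (\<rho> i) (\<tau> j))"
proof -
  note H' = dfn_definable3[OF definable_dpred[OF H]]
  have "dfn (\<lambda>\<rho> \<sigma> \<tau>. \<exists>A B C t. ((\<exists>y\<in>T. seq_val A B C t 0 = y \<and> y \<in> {y0}) \<and>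
     (\<forall>k. k \<in> K0 mem \<longrightarrow> \<rho> i - 1 - k \<in> K0 mem \<longrightarrow>
        (\<exists>y\<in>T. \<exists>z\<in>T. seq_val A B C t k = y \<and> seq_val A B C t (k + 1) = z \<and> inK k # y @ z \<in> H))) \<and>
     seq_val A B C t (\<rho> i) = \<tau> j)"
    by (intro dfn_definable1[OF definable_singleton] H' dfn_seq_val dfn_NN dfn_intros)
  then show ?thesis
    by (rule dfn_cong) (simp add: reached_def computation_def seq_val_tuple)
qed

lemma computation_extend:
  assumes n: "n \<in> K0 mem" and c: "computation H n A B C t"
    and z: "z \<in> T" "inK n # seq_val A B C t n @ z \<in> H"
  shows "\<exists>A' B' C' t'. computation H (n + 1) A' B' C' t' \<and> seq_val A' B' C' t' (n + 1) = z"
proof -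
  obtain A' B' C' t' where new: "seq_val A' B' C' t' (n + 1) = z" and
    old: "\<And>k. k \<in> K0 mem \<Longrightarrow> k \<noteq> n + 1 \<Longrightarrow> seq_val A' B' C' t' k = seq_val A B C t k"
    using seq_val_extend[OF succ_NN[OF n] z(1)] by blast
  have "seq_val A' B' C' t' 0 = y0"
    using old[OF zero_NN] succ_NN_nonzero[OF n] c by (simp add: computation_def)
  moreover have "inK k # seq_val A' B' C' t' k @ seq_val A' B' C' t' (k + 1) \<in> H"
    if k: "k \<in> K0 mem" "n + 1 - 1 - k \<in> K0 mem" for k
  proof (cases "n = k")
    case True
    then show ?thesis using old[OF n] new z(2) by simp
  next
    case False
    then have nk: "n - 1 - k \<in> K0 mem" using pred_NN[OF k(2)] by (simp add: algebra_simps)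
    moreover have "k \<noteq> n + 1" using k(2) minus_one_notin_NN by auto
    ultimately show ?thesis
      using old[OF k(1)] old[OF succ_NN[OF k(1)]] c k(1) False by (simp add: computation_def)
  qed
  ultimately show ?thesis using new unfolding computation_def by blast
qed

lemma reached_tuple: "reached H n y \<Longrightarrow> y \<in> T"
  by (auto simp: reached_def seq_val_tuple)

lemma reached_0: "reached H 0 y \<longleftrightarrow> y = y0"
proof
  assume "y = y0"
  obtain A B C t where v: "seq_val A B C t 0 = y0"
    using seq_val_extend[OF zero_NN y0_tuple] by blast
  have "- 1 - k \<notin> K0 mem" if "k \<in> K0 mem" for k
    using add_NN[OF _ that, of "- 1 - k"] minus_one_notin_NN by auto
  with v have "computation H 0 A B C t" by (auto simp: computation_def)
  with v \<open>y = y0\<close> show "reached H 0 y" unfolding reached_def by blast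
qed (auto simp: reached_def computation_def)

text \<open>
  One direction restricts a computation to its first steps, where \<open>y\<close> is the only value that can be
  reached; the other extends a computation by one entry.
\<close>

lemma reached_Suc:
  assumes n: "n \<in> K0 mem" and y: "\<And>y'. reached H n y' \<longleftrightarrow> y' = y" and z: "z \<in> T"
  shows "reached H (n + 1) z \<longleftrightarrow> inK n # y @ z \<in> H"
proof
  assume "reached H (n + 1) z"
  then obtain A B C t where c: "computation H (n + 1) A B C t" and v: "seq_val A B C t (n + 1) = z"
    unfolding reached_def by blast
  have "n - k \<in> K0 mem" if "n - 1 - k \<in> K0 mem" for k
    using succ_NN[OF that] by (simp add: algebra_simps)
  then have "computation H n A B C t" using c by (simp add: computation_def)
  then have "seq_val A B C t n = y" using y unfolding reached_def by blast
  moreover have "inK n # seq_val A B C t n @ seq_val A B C t (n + 1) \<in> H"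
    using c n zero_NN by (simp add: computation_def)
  ultimately show "inK n # y @ z \<in> H" using v by simp
next
  assume H: "inK n # y @ z \<in> H"
  have "reached H n y" using y by simp
  then show "reached H (n + 1) z"
    using computation_extend[OF n _ z, of H] H unfolding reached_def by metis
qed

theorem recursion:
  fixes h :: "'k \<Rightarrow> ('k, 'f) imag list \<Rightarrow> ('k, 'f) imag list"
  assumes Y: "definable Meq ss Y" and y0Y: "y0 \<in> Y"
    and hY: "\<And>n y. n \<in> K0 mem \<Longrightarrow> y \<in> Y \<Longrightarrow> h n y \<in> Y"
    and h: "definable Meq (fieldK # ss @ ss) {inK n # y @ h n y | n y. n \<in> K0 mem \<and> y \<in> Y}"
  shows "\<exists>!f. f \<in> K0 mem \<rightarrow>\<^sub>E Y \<and>
           definable Meq (fieldK # ss) {inK n # f n | n. n \<in> K0 mem} \<and>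
           f 0 = y0 \<and> (\<forall>n\<in>K0 mem. f (n + 1) = h n (f n))"
proof -
  let ?H = "{inK n # y @ h n y | n y. n \<in> K0 mem \<and> y \<in> Y}"
  have YT: "Y \<subseteq> T" using Y by (rule definable_subset)
  have memH: "inK n # y @ z \<in> ?H \<longleftrightarrow> n \<in> K0 mem \<and> y \<in> Y \<and> z = h n y"
    if "y \<in> T" for n y z
  proof -
    have len: "length y' = length y" if "y' \<in> Y" for y'
      using tuples_length[OF subsetD[OF YT that]] tuples_length[OF \<open>y \<in> T\<close>] by simp
    show ?thesis
    proof
      assume "inK n # y @ z \<in> ?H"
      then obtain y' where "y @ z = y' @ h n y'" "n \<in> K0 mem" "y' \<in> Y" by auto
      with len[of y'] show "n \<in> K0 mem \<and> y \<in> Y \<and> z = h n y" by simp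
    qed blast
  qed
  have total: "\<exists>y\<in>T. y \<in> Y \<and> (\<forall>z. reached ?H n z \<longleftrightarrow> z = y)" if n: "n \<in> K0 mem" for n
  proof -
    have "\<exists>y\<in>T. y \<in> Y \<and> (\<forall>z\<in>T. reached ?H n z \<longleftrightarrow> z = y)"
    proof (rule NN_induct[where S = "\<lambda>n. \<exists>y\<in>T. y \<in> Y \<and> (\<forall>z\<in>T. reached ?H n z \<longleftrightarrow> z = y)", OF _ _ _ n])
      show "dfn (\<lambda>\<rho> \<sigma> \<tau>. \<exists>y\<in>T. y \<in> Y \<and> (\<forall>z\<in>T. reached ?H (\<rho> 0) z \<longleftrightarrow> z = y))"
        by (intro dfn_exT dfn_allT dfn_conj dfn_iff dfn_definable1[OF Y] dfn_reached[OF h] dfn_tuple_eq)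
      show "\<exists>y\<in>T. y \<in> Y \<and> (\<forall>z\<in>T. reached ?H 0 z \<longleftrightarrow> z = y)"
        using y0Y y0_tuple by (auto simp: reached_0)
    next
      fix n assume n: "n \<in> K0 mem" and "\<exists>y\<in>T. y \<in> Y \<and> (\<forall>z\<in>T. reached ?H n z \<longleftrightarrow> z = y)"
      then obtain y where y: "y \<in> T" "y \<in> Y" "\<And>z. z \<in> T \<Longrightarrow> reached ?H n z \<longleftrightarrow> z = y" by blast
      have "reached ?H n z \<longleftrightarrow> z = y" for z
        using y(1,3) reached_tuple by blast
      from reached_Suc[OF n this] memH[OF y(1)] n y(2)
      have "\<And>z. z \<in> T \<Longrightarrow> reached ?H (n + 1) z \<longleftrightarrow> z = h n y" by blast
      moreover have "h n y \<in> Y" using hY n y(2) .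
      ultimately show "\<exists>y\<in>T. y \<in> Y \<and> (\<forall>z\<in>T. reached ?H (n + 1) z \<longleftrightarrow> z = y)"
        using YT by blast
    qed
    then show ?thesis using reached_tuple by blast
  qed
  then have "\<forall>n\<in>K0 mem. \<exists>y. y \<in> T \<and> y \<in> Y \<and> (\<forall>z. reached ?H n z \<longleftrightarrow> z = y)" by blast
  from bchoice[OF this] obtain F where
    F': "\<forall>n\<in>K0 mem. F n \<in> T \<and> F n \<in> Y \<and> (\<forall>z. reached ?H n z \<longleftrightarrow> z = F n)" ..
  then have F: "\<And>n. n \<in> K0 mem \<Longrightarrow> F n \<in> T" "\<And>n. n \<in> K0 mem \<Longrightarrow> F n \<in> Y"
    "\<And>n z. n \<in> K0 mem \<Longrightarrow> reached ?H n z \<longleftrightarrow> z = F n"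
    by blast+
  have F_succ: "F (n + 1) = h n (F n)" if n: "n \<in> K0 mem" for n
  proof -
    have "inK n # F n @ h n (F n) \<in> ?H" using n F(2) by blast
    then have "reached ?H (n + 1) (h n (F n))"
      using reached_Suc[OF n F(3)[OF n]] hY[OF n F(2)[OF n]] YT by blast
    then show ?thesis using F(3)[OF succ_NN[OF n]] by simp
  qed
  define f where "f = restrict F (K0 mem)"
  have f: "f n = F n" if "n \<in> K0 mem" for n using that by (simp add: f_def)
  show ?thesis
  proof (rule ex1I[of _ f], intro conjI ballI)
    show "f \<in> K0 mem \<rightarrow>\<^sub>E Y" using F(2) by (auto simp: f_def)
    have "dfn (\<lambda>\<rho> \<sigma> \<tau>. \<rho> 0 \<in> K0 mem \<and> reached ?H (\<rho> 0) (\<tau> 0))"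
      by (intro dfn_conj dfn_NN trm_var dfn_reached[OF h])
    from definable_graph[OF this]
    have "definable Meq (fieldK # ss) {inK n # y | n y. y \<in> T \<and> n \<in> K0 mem \<and> reached ?H n y}" .
    also have "{inK n # y | n y. y \<in> T \<and> n \<in> K0 mem \<and> reached ?H n y} = {inK n # f n | n. n \<in> K0 mem}"
      using F(1,3) f by auto
    finally show "definable Meq (fieldK # ss) {inK n # f n | n. n \<in> K0 mem}" .
    show "f 0 = y0" using F(3)[OF zero_NN, of y0] f[OF zero_NN] by (simp add: reached_0)
    fix n assume n: "n \<in> K0 mem"
    show "f (n + 1) = h n (f n)" using F_succ[OF n] f n succ_NN[OF n] by simp
  next
    \<comment> \<open>A rival solution can enter the induction because its graph is definable.\<close>
    fix g assume g: "g \<in> K0 mem \<rightarrow>\<^sub>E Y \<and>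
           definable Meq (fieldK # ss) {inK n # g n | n. n \<in> K0 mem} \<and>
           g 0 = y0 \<and> (\<forall>n\<in>K0 mem. g (n + 1) = h n (g n))"
    let ?G = "{inK n # g n | n. n \<in> K0 mem}"
    have "\<exists>y\<in>T. inK n # y \<in> ?G \<and> reached ?H n y" if n: "n \<in> K0 mem" for n
    proof (rule NN_induct[where S = "\<lambda>n. \<exists>y\<in>T. inK n # y \<in> ?G \<and> reached ?H n y", OF _ _ _ n])
      show "dfn (\<lambda>\<rho> \<sigma> \<tau>. \<exists>y\<in>T. inK (\<rho> 0) # y \<in> ?G \<and> reached ?H (\<rho> 0) y)"
        by (intro dfn_exT dfn_conj dfn_definable2 dfn_reached[OF h]) (use g in blast)
      show "\<exists>y\<in>T. inK 0 # y \<in> ?G \<and> reached ?H 0 y"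
        using g y0_tuple zero_NN by (auto simp: reached_0)
    next
      fix n assume n: "n \<in> K0 mem" and "\<exists>y\<in>T. inK n # y \<in> ?G \<and> reached ?H n y"
      then have "g n = F n" using F(3)[OF n] by auto
      then have "g (n + 1) = F (n + 1)"
        using g n F_succ[OF n] by simp
      then show "\<exists>y\<in>T. inK (n + 1) # y \<in> ?G \<and> reached ?H (n + 1) y"
        using F(1,3) succ_NN[OF n] by auto
    qed
    then have "g n = f n" if "n \<in> K0 mem" for n using F(3) f that by auto
    then show "g = f" using g by (intro PiE_ext[of _ "K0 mem" "\<lambda>_. Y"]) (auto simp: f_def F(2))
  qed
qed

end

theorem proposition7p12:
  fixes mem :: "'k::field \<Rightarrow> 'f \<Rightarrow> bool"
    and ss :: "('k, 'f) imag_sort list"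
    and Y :: "('k, 'f) imag list set"
    and y0 :: "('k, 'f) imag list"
    and h :: "'k \<Rightarrow> ('k, 'f) imag list \<Rightarrow> ('k, 'f) imag list"
  assumes "definable_char_zero mem"
    and "definable (eq_struct (kf_struct mem)) ss Y"
    and "y0 \<in> Y"
    and "\<And>n y. n \<in> NN mem \<Longrightarrow> y \<in> Y \<Longrightarrow> h n y \<in> Y"
    and "definable (eq_struct (kf_struct mem)) (fieldK # ss @ ss)
           {inK n # y @ h n y | n y. n \<in> NN mem \<and> y \<in> Y}"
  shows "\<exists>!f. f \<in> NN mem \<rightarrow>\<^sub>E Y \<and>
           definable (eq_struct (kf_struct mem)) (fieldK # ss) {inK n # f n | n. n \<in> NN mem} \<and>
           f 0 = y0 \<and>
           (\<forall>n\<in>NN mem. f (n + 1) = h n (f n))"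
proof -
  have sorts: "set ss \<subseteq> sorts (eq_struct (kf_struct mem))"
    using assms(2) by (simp add: definable_over_def)
  have "y0 \<in> tuples (eq_struct (kf_struct mem)) ss"
    using assms(3) definable_subset[OF assms(2)] by blast
  with assms(1) sorts interpret imaginary_tuples mem ss y0
    by unfold_locales
  show ?thesis by (rule recursion[OF assms(2-5)])
qed

end
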